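(* Let $\mathcal V$ and $\mathcal V^n$ be the variance processes given by $$d\mathcal V(t)=\mathfrak C\mathcal V(t)\,dt+d\mathcal L(t),\ \ \mathcal V(0)=\mathcal V_0,\qquad d\mathcal V^n(t)=\mathfrak C^n\mathcal V^n(t)\,dt+d\mathcal L^n(t),\ \ \mathcal V^n(0)=\mathcal V^n_0,$$ with $\mathcal V_0^n=\mathcal V_0$, $\mathcal L^n=\mathcal L$ and $\mathfrak C^n,\mathfrak C\in L(\mathcal B_1)$ for all $n\ge1$, where $\mathcal B_1$ denotes the Banach space of trace class operators on $H$ with norm $\|\cdot\|_1$, and $\mathcal L(t)=\sum_{i=1}^{N(t)}\mathcal X_i$ is a compound Poisson process. Suppose that $\mathcal V(t)$ and $\mathcal V^n(t)$ are non-negative definite and trace class. Then there is a constant $k>0$ such that for every $T>0$, $$\mathbb E\Big[\sup_{0\le t\le T}\big\|\sqrt{\mathcal V(t)}-\sqrt{\mathcal V^n(t)}\big\|_{\mathcal H}^2\Big]\le C(T)\,\|\mathfrak C-\mathfrak C^n\|_{\mathrm{op}},$$ where $C(T)=kT\,e^{T(\|\mathfrak C\|_{\mathrm{op}}\vee\|\mathfrak C^n\|_{\mathrm{op}})}\big(\mathbb E[\|\mathcal V_0\|_1]+\lambda T\,\mathbb E[\|\mathcal X_i\|_1]\big)$.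
   Context: $H$ is a separable real Hilbert space and $\mathcal H=L_{HS}(H)$ is the Hilbert space of Hilbert-Schmidt operators on $H$ with norm $\|\cdot\|_{\mathcal H}$. Trace class operators on $H$ are the compact operators with finite trace norm $\|\mathcal T\|_1:=\|(\mathcal T^*\mathcal T)^{1/4}\|_{\mathcal H}^2$. $\mathfrak C,\mathfrak C^n$ are bounded operators on $\mathcal H$ that also act as bounded operators on $\mathcal B_1$; $\|\cdot\|_{\mathrm{op}}$ is the operator norm in $L(\mathcal B_1)$, and $x\vee y=\max(x,y)$. $N$ is a Poisson process with intensity $\lambda>0$; $(\mathcal X_i)_{i\ge1}$ are i.i.d. $\mathcal H$-valued random variables independent of $N$, so $\mathbb E[\|\mathcal X_i\|_1]$ does not depend on $i$. The solution is $\mathcal V(t)=e^{\mathfrak Ct}\mathcal V_0+\int_0^te^{\mathfrak C(t-s)}d\mathcal L(s)=e^{\mathfrak Ct}\mathcal V_0+\sum_{i:T_i\le t}e^{\mathfrak C(t-T_i)}\mathcal X_i$, with $T_i$ the jump times of $N$; similarly for $\mathcal V^n$ with $\mathfrak C^n$. "Non-negative definite" operators are self-adjoint, and $\sqrt A$ denotes the unique non-negative definite operator with $\sqrt A\sqrt A=A$. *)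

theory Defs
  imports "HOL-Probability.Probability"
begin

section \<open>Orthonormal bases\<close>

definition orthonormal :: "'h::real_inner set \<Rightarrow> bool" where
  "orthonormal B \<longleftrightarrow> pairwise orthogonal B \<and> (\<forall>e\<in>B. norm e = 1)"

definition orthonormal_basis :: "'h::real_inner set \<Rightarrow> bool" where
  "orthonormal_basis B \<longleftrightarrow> orthonormal B \<and> closure (span B) = UNIV"

lemma orthogonal_projection_exists:
  fixes x :: "'h::{real_inner,banach}"
  shows "\<exists>p\<in>closure (span B). \<forall>e\<in>B. norm e = 1 \<longrightarrow> inner (x - p) e = 0"
proof -
  define S where "S = span B"
  have S0: "S \<noteq> {}" unfolding S_def using span_zero by blast
  define d where "d = infdist x S"
  have d0: "0 \<le> d" by (simp add: d_def infdist_nonneg)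
  have dle: "d \<le> norm (x - s)" if "s \<in> S" for s
    using infdist_le[OF that, of x] by (simp add: d_def dist_norm)
  have ex: "\<exists>s\<in>S. (norm (x - s))\<^sup>2 \<le> d\<^sup>2 + inverse (real (Suc n))" for n
  proof -
    define r where "r = sqrt (d\<^sup>2 + inverse (real (Suc n)))"
    have "sqrt (d\<^sup>2) < r" unfolding r_def by (intro real_sqrt_less_mono) simp
    hence "d < r" using d0 by simp
    hence "(INF a\<in>S. dist x a) < r"
      using S0 by (simp add: d_def infdist_def)
    then obtain s where s: "s \<in> S" "dist x s < r"
      using S0 by (subst (asm) cINF_less_iff) (auto intro!: bdd_belowI2[where m=0])
    have "(norm (x - s))\<^sup>2 \<le> r\<^sup>2"
      using s by (intro power_mono) (auto simp: dist_norm)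
    also have "r\<^sup>2 = d\<^sup>2 + inverse (real (Suc n))" unfolding r_def
      by (subst real_sqrt_pow2) (auto intro!: add_nonneg_nonneg)
    finally show ?thesis using s by blast
  qed
  then obtain s where sS: "\<And>n. s n \<in> S"
    and sn: "\<And>n. (norm (x - s n))\<^sup>2 \<le> d\<^sup>2 + inverse (real (Suc n))" by metis
  have par: "(norm (s n - s m))\<^sup>2 \<le> 2 * inverse (real (Suc n)) + 2 * inverse (real (Suc m))" for n m
  proof -
    have "(1/2) *\<^sub>R (s n + s m) \<in> S"
      unfolding S_def using sS by (auto simp: S_def intro: span_scale span_add)
    hence "d \<le> norm (x - (1/2) *\<^sub>R (s n + s m))" by (rule dle)
    hence "d\<^sup>2 \<le> (norm (x - (1/2) *\<^sub>R (s n + s m)))\<^sup>2" using d0 by (intro power_mono) auto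
    moreover have "(norm (s n - s m))\<^sup>2 = 2 * (norm (x - s n))\<^sup>2 + 2 * (norm (x - s m))\<^sup>2
       - 4 * (norm (x - (1/2) *\<^sub>R (s n + s m)))\<^sup>2"
      by (simp add: power2_norm_eq_inner inner_diff inner_add inner_commute algebra_simps)
    ultimately show ?thesis using sn[of n] sn[of m] by linarith
  qed
  have "Cauchy s"
  proof (rule metric_CauchyI)
    fix e :: real assume e: "0 < e"
    obtain N where N: "inverse (real (Suc N)) < e\<^sup>2 / 4"
      using reals_Archimedean[of "e\<^sup>2/4"] e by auto
    have "dist (s m) (s n) < e" if "m \<ge> N" "n \<ge> N" for m n
    proof -
      have "inverse (real (Suc m)) \<le> inverse (real (Suc N))" "inverse (real (Suc n)) \<le> inverse (real (Suc N))"
        using that by (auto intro!: le_imp_inverse_le)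
      with par[of m n] N have "(norm (s m - s n))\<^sup>2 < e\<^sup>2" by linarith
      thus ?thesis using e by (simp add: dist_norm power_less_imp_less_base)
    qed
    thus "\<exists>N. \<forall>m\<ge>N. \<forall>n\<ge>N. dist (s m) (s n) < e" by blast
  qed
  then obtain p where p: "s \<longlonglongrightarrow> p" using Cauchy_convergent convergent_def by blast
  have pS: "p \<in> closure S" using p sS closure_sequential by blast
  have pd: "(norm (x - p))\<^sup>2 \<le> d\<^sup>2"
  proof (rule LIMSEQ_le)
    show "(\<lambda>n. (norm (x - s n))\<^sup>2) \<longlonglongrightarrow> (norm (x - p))\<^sup>2" by (intro tendsto_intros p)
    show "(\<lambda>n. d\<^sup>2 + inverse (real (Suc n))) \<longlonglongrightarrow> d\<^sup>2"
      using tendsto_add[OF tendsto_const[of "d\<^sup>2"] LIMSEQ_inverse_real_of_nat] by simp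
  qed (use sn in blast)
  have "inner (x - p) e = 0" if e: "e \<in> B" "norm e = 1" for e
  proof -
    define c where "c = inner (x - p) e"
    have "d \<le> norm (x - (p + c *\<^sub>R e))"
    proof (rule LIMSEQ_le_const)
      show "(\<lambda>n. norm (x - (s n + c *\<^sub>R e))) \<longlonglongrightarrow> norm (x - (p + c *\<^sub>R e))"
        by (intro tendsto_intros p)
      have "s n + c *\<^sub>R e \<in> S" for n
        using sS[of n] e by (auto simp: S_def intro: span_add span_scale span_base)
      thus "\<exists>N. \<forall>n\<ge>N. d \<le> norm (x - (s n + c *\<^sub>R e))" using dle by blast
    qed
    hence "d\<^sup>2 \<le> (norm (x - (p + c *\<^sub>R e)))\<^sup>2" using d0 by (intro power_mono) auto
    also have "\<dots> = (norm ((x - p) - c *\<^sub>R e))\<^sup>2" by (simp add: algebra_simps)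
    also have "\<dots> = (norm (x - p))\<^sup>2 - 2 * c * inner (x - p) e + c\<^sup>2 * (norm e)\<^sup>2"
      unfolding power2_norm_eq_inner
      by (simp add: inner_diff_left inner_diff_right inner_commute power2_eq_square algebra_simps)
    also have "\<dots> = (norm (x - p))\<^sup>2 - c\<^sup>2"
      using e by (simp add: c_def[symmetric] power2_eq_square)
    finally have "c\<^sup>2 \<le> 0" using pd by linarith
    thus ?thesis by (simp add: c_def)
  qed
  thus ?thesis using pS unfolding S_def by blast
qed

lemma orthonormal_basis_exists: "\<exists>B::'h::{real_inner,banach} set. orthonormal_basis B"
proof -
  have "\<exists>B\<in>{B::'h set. orthonormal B}. \<forall>X\<in>{B. orthonormal B}. B \<subseteq> X \<longrightarrow> X = B"
  proof (rule subset_Zorn)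
    fix \<C> :: "'h set set" assume c: "subset.chain {B. orthonormal B} \<C>"
    have "orthonormal (\<Union>\<C>)"
      unfolding orthonormal_def
    proof (intro conjI)
      show "pairwise orthogonal (\<Union>\<C>)"
      proof (rule pairwiseI)
        fix x y assume "x \<in> \<Union>\<C>" "y \<in> \<Union>\<C>" and ne: "x \<noteq> y"
        then obtain A B where AB: "A \<in> \<C>" "x \<in> A" "B \<in> \<C>" "y \<in> B" by blast
        hence "A \<subseteq> B \<or> B \<subseteq> A" using c unfolding subset_chain_def by blast
        moreover have "orthonormal A" "orthonormal B" using c AB unfolding subset_chain_def by auto
        ultimately show "orthogonal x y"
          using AB ne unfolding orthonormal_def pairwise_def by blast
      qed
      show "\<forall>e\<in>\<Union>\<C>. norm e = 1"
        using c unfolding subset_chain_def orthonormal_def by blast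
    qed
    thus "\<exists>U\<in>{B. orthonormal B}. \<forall>X\<in>\<C>. X \<subseteq> U" by blast
  qed
  then obtain B :: "'h set" where B: "orthonormal B"
    and mx: "\<And>X. orthonormal X \<Longrightarrow> B \<subseteq> X \<Longrightarrow> X = B" by auto
  have "x \<in> closure (span B)" for x
  proof -
    obtain p where p: "p \<in> closure (span B)" "\<forall>e\<in>B. norm e = 1 \<longrightarrow> inner (x - p) e = 0"
      using orthogonal_projection_exists by blast
    have orth: "inner (x - p) e = 0" if "e \<in> B" for e
      using p(2) B that by (auto simp: orthonormal_def)
    have "x = p"
    proof (rule ccontr)
      assume "x \<noteq> p"
      hence n0: "norm (x - p) \<noteq> 0" by simp
      define u where "u = (1 / norm (x - p)) *\<^sub>R (x - p)"
      have u1: "norm u = 1" using n0 by (simp add: u_def)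
      have uo: "inner u e = 0" if "e \<in> B" for e using orth[OF that] by (simp add: u_def)
      have "orthonormal (insert u B)"
        using B u1 uo by (auto simp: orthonormal_def pairwise_insert orthogonal_def inner_commute)
      hence "u \<in> B" using mx[of "insert u B"] by blast
      hence "inner u u = 0" using uo by blast
      thus False using u1 by simp
    qed
    thus ?thesis using p by simp
  qed
  thus ?thesis using B unfolding orthonormal_basis_def by blast
qed

definition onb :: "'h::{real_inner,banach} set" where
  "onb = (SOME B. orthonormal_basis B)"

lemma orthonormal_basis_onb: "orthonormal_basis (onb :: 'h::{real_inner,banach} set)"
  unfolding onb_def using someI_ex[OF orthonormal_basis_exists] .

lemma blinfun_eq_on_onb:
  fixes A :: "'h::{real_inner,banach} \<Rightarrow>\<^sub>L 'k::real_normed_vector"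
  assumes "\<And>e. e \<in> onb \<Longrightarrow> A e = 0"
  shows "A = 0"
proof -
  have "closure (span onb) \<subseteq> {x. A x = 0}"
  proof (rule closure_minimal)
    show "span onb \<subseteq> {x. A x = 0}"
    proof
      fix x :: 'h assume "x \<in> span onb"
      thus "x \<in> {x. A x = 0}"
        by (induction rule: span_induct_alt) (auto simp: assms blinfun.add_right blinfun.scaleR_right)
    qed
    show "closed {x. A x = 0}"
      by (intro closed_Collect_eq continuous_intros)
  qed
  thus ?thesis using orthonormal_basis_onb unfolding orthonormal_basis_def
    by (intro blinfun_eqI) auto
qed

section \<open>Hilbert-Schmidt operators\<close>

text \<open>The class, the inner product and the norm do not depend on the basis chosen by \<^const>\<open>onb\<close>.\<close>

definition hilbert_schmidt :: "('h::{real_inner,banach} \<Rightarrow>\<^sub>L 'h) \<Rightarrow> bool" where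
  "hilbert_schmidt A \<longleftrightarrow> (\<lambda>e. (norm (A e))\<^sup>2) summable_on onb"

lemma hilbert_schmidt_inner_summable:
  assumes "hilbert_schmidt A" "hilbert_schmidt B"
  shows "(\<lambda>e. inner (A e) (B e)) summable_on onb"
proof -
  have "(\<lambda>e. norm (inner (A e) (B e))) summable_on onb"
  proof (rule summable_on_comparison_test)
    show "(\<lambda>e. (norm (A e))\<^sup>2 + (norm (B e))\<^sup>2) summable_on onb"
      using assms unfolding hilbert_schmidt_def by (intro summable_on_add)
    fix e :: 'a
    have "norm (inner (A e) (B e)) \<le> norm (A e) * norm (B e)"
      using Cauchy_Schwarz_ineq2 by auto
    also have "\<dots> \<le> (norm (A e))\<^sup>2 + (norm (B e))\<^sup>2"
      using sum_squares_bound[of "norm (A e)" "norm (B e)"]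
        mult_nonneg_nonneg[OF norm_ge_zero[of "A e"] norm_ge_zero[of "B e"]] by linarith
    finally show "norm (inner (A e) (B e)) \<le> (norm (A e))\<^sup>2 + (norm (B e))\<^sup>2" .
  qed simp
  thus ?thesis by (subst summable_on_iff_abs_summable_on_real)
qed

lemma hilbert_schmidt_zero: "hilbert_schmidt 0"
  by (simp add: hilbert_schmidt_def)

lemma hilbert_schmidt_scaleR: "hilbert_schmidt A \<Longrightarrow> hilbert_schmidt (r *\<^sub>R A)"
  by (simp add: hilbert_schmidt_def blinfun.scaleR_left power_mult_distrib summable_on_cmult_right)

lemma hilbert_schmidt_add:
  assumes "hilbert_schmidt A" "hilbert_schmidt B"
  shows "hilbert_schmidt (A + B)"
proof -
  have "(\<lambda>e. (norm (A e))\<^sup>2 + 2 * inner (A e) (B e) + (norm (B e))\<^sup>2) summable_on onb"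
    using assms hilbert_schmidt_inner_summable[OF assms]
    by (intro summable_on_add summable_on_cmult_right) (auto simp: hilbert_schmidt_def)
  moreover have "(norm ((A + B) e))\<^sup>2 = (norm (A e))\<^sup>2 + 2 * inner (A e) (B e) + (norm (B e))\<^sup>2" for e
    by (simp add: blinfun.add_left power2_norm_eq_inner inner_add inner_commute)
  ultimately show ?thesis by (simp add: hilbert_schmidt_def)
qed

lemma hilbert_schmidt_uminus: "hilbert_schmidt A \<Longrightarrow> hilbert_schmidt (- A)"
  by (simp add: hilbert_schmidt_def blinfun.minus_left)

lemma hilbert_schmidt_diff:
  "hilbert_schmidt A \<Longrightarrow> hilbert_schmidt B \<Longrightarrow> hilbert_schmidt (A - B)"
  using hilbert_schmidt_add[OF _ hilbert_schmidt_uminus, of A B] by (simp only: diff_conv_add_uminus)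

typedef (overloaded) 'h hs = "{A :: 'h::{real_inner,banach} \<Rightarrow>\<^sub>L 'h. hilbert_schmidt A}"
  using hilbert_schmidt_zero by blast

setup_lifting type_definition_hs

instantiation hs :: ("{real_inner,banach}") real_inner
begin

lift_definition zero_hs :: "'a hs" is 0 by (rule hilbert_schmidt_zero)
lift_definition plus_hs :: "'a hs \<Rightarrow> 'a hs \<Rightarrow> 'a hs" is "(+)" by (rule hilbert_schmidt_add)
lift_definition minus_hs :: "'a hs \<Rightarrow> 'a hs \<Rightarrow> 'a hs" is "(-)" by (rule hilbert_schmidt_diff)
lift_definition uminus_hs :: "'a hs \<Rightarrow> 'a hs" is uminus by (rule hilbert_schmidt_uminus)
lift_definition scaleR_hs :: "real \<Rightarrow> 'a hs \<Rightarrow> 'a hs" is scaleR by (rule hilbert_schmidt_scaleR)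
lift_definition inner_hs :: "'a hs \<Rightarrow> 'a hs \<Rightarrow> real"
  is "\<lambda>(A :: 'a \<Rightarrow>\<^sub>L 'a) (B :: 'a \<Rightarrow>\<^sub>L 'a). \<Sum>\<^sub>\<infinity>e\<in>onb. inner (A e) (B e)" .

definition norm_hs :: "'a hs \<Rightarrow> real" where
  "norm_hs A = sqrt (inner A A)"
definition dist_hs :: "'a hs \<Rightarrow> 'a hs \<Rightarrow> real" where
  "dist_hs A B = norm (A - B)"
definition sgn_hs :: "'a hs \<Rightarrow> 'a hs" where
  "sgn_hs A = inverse (norm A) *\<^sub>R A"
definition uniformity_hs :: "('a hs \<times> 'a hs) filter" where
  "uniformity_hs = (INF e\<in>{0<..}. principal {(A, B). dist A B < e})"
definition open_hs :: "'a hs set \<Rightarrow> bool" where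
  "open_hs U \<longleftrightarrow> (\<forall>A\<in>U. eventually (\<lambda>(A', B). A' = A \<longrightarrow> B \<in> U) uniformity)"

instance
proof
  fix A B C :: "'a hs" and r s :: real and U :: "'a hs set"
  show "A + B + C = A + (B + C)" by transfer simp
  show "A + B = B + A" by transfer simp
  show "0 + A = A" by transfer simp
  show "- A + A = 0" by transfer simp
  show "A - B = A + - B" by transfer simp
  show "r *\<^sub>R (A + B) = r *\<^sub>R A + r *\<^sub>R B" by transfer (simp add: scaleR_add_right)
  show "(r + s) *\<^sub>R A = r *\<^sub>R A + s *\<^sub>R A" by transfer (simp add: scaleR_add_left)
  show "r *\<^sub>R s *\<^sub>R A = (r * s) *\<^sub>R A" by transfer simp
  show "1 *\<^sub>R A = A" by transfer simp
  show "dist A B = norm (A - B)" by (rule dist_hs_def)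
  show "sgn A = inverse (norm A) *\<^sub>R A" by (rule sgn_hs_def)
  show "uniformity = (INF e\<in>{0<..}. principal {(A, B::'a hs). dist A B < e})"
    by (rule uniformity_hs_def)
  show "open U \<longleftrightarrow> (\<forall>A\<in>U. eventually (\<lambda>(A', B). A' = A \<longrightarrow> B \<in> U) uniformity)"
    by (rule open_hs_def)
  show "norm A = sqrt (inner A A)" by (rule norm_hs_def)
  show "inner A B = inner B A" by transfer (simp add: inner_commute)
  show "inner (A + B) C = inner A C + inner B C"
    by transfer (simp add: blinfun.add_left inner_add_left infsum_add hilbert_schmidt_inner_summable)
  show "inner (r *\<^sub>R A) B = r * inner A B"
    by transfer (simp add: blinfun.scaleR_left infsum_cmult_right hilbert_schmidt_inner_summable)
  show "0 \<le> inner A A" by transfer (simp add: infsum_nonneg)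
  show "inner A A = 0 \<longleftrightarrow> A = 0"
  proof transfer
    fix A :: "'a \<Rightarrow>\<^sub>L 'a" assume A: "hilbert_schmidt A"
    have "A = 0" if z: "(\<Sum>\<^sub>\<infinity>e\<in>onb. inner (A e) (A e)) = 0"
    proof (rule blinfun_eq_on_onb)
      fix e :: 'a assume "e \<in> onb"
      hence "inner (A e) (A e) = 0"
        using nonneg_infsum_le_0D[of "\<lambda>e. inner (A e) (A e)" onb e]
          hilbert_schmidt_inner_summable[OF A A] z by simp
      thus "A e = 0" by simp
    qed
    thus "((\<Sum>\<^sub>\<infinity>e\<in>onb. inner (A e) (A e)) = 0) = (A = 0)" by auto
  qed
qed

end

lemma hs_norm_square: "(norm A)\<^sup>2 = (\<Sum>\<^sub>\<infinity>e\<in>onb. (norm (Rep_hs A e))\<^sup>2)"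
  by (simp add: power2_norm_eq_inner inner_hs.rep_eq)

lemma hs_sum_le_norm:
  assumes "finite F" "F \<subseteq> onb"
  shows "(\<Sum>e\<in>F. (norm (Rep_hs A e))\<^sup>2) \<le> (norm A)\<^sup>2"
  unfolding hs_norm_square
  using assms Rep_hs[of A] by (intro finite_sum_le_infsum) (auto simp: hilbert_schmidt_def)

lemma norm_Rep_hs_le: "norm (Rep_hs A) \<le> norm A"
proof (rule norm_blinfun_bound)
  have "closure (span onb) \<subseteq> {x. norm (Rep_hs A x) \<le> norm A * norm x}"
  proof (rule closure_minimal)
    show "closed {x. norm (Rep_hs A x) \<le> norm A * norm x}"
      by (intro closed_Collect_le continuous_intros)
    show "span onb \<subseteq> {x. norm (Rep_hs A x) \<le> norm A * norm x}"
    proof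
      fix x :: 'a assume "x \<in> span onb"
      then obtain F c where F: "finite F" "F \<subseteq> onb" and x: "x = (\<Sum>e\<in>F. c e *\<^sub>R e)"
        unfolding span_explicit by blast
      have o: "inner e f = (if e = f then 1 else 0)" if "e \<in> F" "f \<in> F" for e f
        using that F orthonormal_basis_onb
        by (auto simp: orthonormal_basis_def orthonormal_def pairwise_def orthogonal_def
            norm_eq_1 subset_iff)
      have "(norm x)\<^sup>2 = (\<Sum>e\<in>F. \<Sum>f\<in>F. c e * (c f * inner f e))"
        unfolding x power2_norm_eq_inner
        by (simp add: inner_sum_left inner_sum_right sum_distrib_left)
      also have "\<dots> = (\<Sum>e\<in>F. \<Sum>f\<in>F. if e = f then (c e)\<^sup>2 else 0)"
        by (intro sum.cong refl) (auto simp: o power2_eq_square)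
      also have "\<dots> = (\<Sum>e\<in>F. (c e)\<^sup>2)" using F by simp
      finally have nx: "norm x = L2_set c F"
        by (simp add: L2_set_def real_sqrt_unique)
      have "norm (Rep_hs A x) = norm (\<Sum>e\<in>F. c e *\<^sub>R Rep_hs A e)"
        by (simp add: x blinfun.sum_right blinfun.scaleR_right)
      also have "\<dots> \<le> (\<Sum>e\<in>F. \<bar>c e\<bar> * \<bar>norm (Rep_hs A e)\<bar>)"
        by (rule sum_norm_le) simp
      also have "\<dots> \<le> L2_set c F * L2_set (\<lambda>e. norm (Rep_hs A e)) F"
        by (rule L2_set_mult_ineq)
      also have "\<dots> \<le> norm x * norm A"
        unfolding nx
        using real_sqrt_le_mono[OF hs_sum_le_norm[OF F, of A]]
        by (intro mult_left_mono) (auto simp: L2_set_def intro: sum_nonneg)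
      finally show "x \<in> {x. norm (Rep_hs A x) \<le> norm A * norm x}" by (simp add: mult.commute)
    qed
  qed
  thus "norm (Rep_hs A x) \<le> norm A * norm x" for x
    using orthonormal_basis_onb unfolding orthonormal_basis_def by auto
qed simp

instance hs :: ("{real_inner,banach}") banach
proof
  fix X :: "nat \<Rightarrow> 'a hs" assume X: "Cauchy X"
  have "Cauchy (\<lambda>n. Rep_hs (X n))"
  proof (rule metric_CauchyI)
    fix e :: real assume "0 < e"
    then obtain N where N: "\<forall>m\<ge>N. \<forall>n\<ge>N. dist (X m) (X n) < e"
      using metric_CauchyD[OF X] by blast
    have "dist (Rep_hs (X m)) (Rep_hs (X n)) \<le> dist (X m) (X n)" for m n
      using norm_Rep_hs_le[of "X m - X n"] by (simp add: dist_norm minus_hs.rep_eq)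
    with N show "\<exists>N. \<forall>m\<ge>N. \<forall>n\<ge>N. dist (Rep_hs (X m)) (Rep_hs (X n)) < e"
      by (meson order_le_less_trans)
  qed
  then obtain T where T: "(\<lambda>n. Rep_hs (X n)) \<longlonglongrightarrow> T"
    using Cauchy_convergent convergent_def by blast
  have fin: "(\<Sum>a\<in>F. (norm ((Rep_hs (X n) - T) a))\<^sup>2) \<le> e\<^sup>2"
    if N: "\<forall>m\<ge>N. \<forall>n\<ge>N. dist (X m) (X n) < e" and n: "N \<le> n" and F: "finite F" "F \<subseteq> onb" for e N n F
  proof (rule LIMSEQ_le_const2)
    show "(\<lambda>m. \<Sum>a\<in>F. (norm ((Rep_hs (X n) - Rep_hs (X m)) a))\<^sup>2)
            \<longlonglongrightarrow> (\<Sum>a\<in>F. (norm ((Rep_hs (X n) - T) a))\<^sup>2)"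
      by (intro tendsto_intros T)
    have "(\<Sum>a\<in>F. (norm ((Rep_hs (X n) - Rep_hs (X m)) a))\<^sup>2) \<le> e\<^sup>2" if "N \<le> m" for m
    proof -
      have "(\<Sum>a\<in>F. (norm (Rep_hs (X n - X m) a))\<^sup>2) \<le> (norm (X n - X m))\<^sup>2"
        by (rule hs_sum_le_norm[OF F])
      also have "\<dots> \<le> e\<^sup>2"
        using N n that by (intro power_mono) (auto simp: dist_norm less_imp_le)
      finally show ?thesis by (simp add: minus_hs.rep_eq)
    qed
    thus "\<exists>N. \<forall>m\<ge>N. (\<Sum>a\<in>F. (norm ((Rep_hs (X n) - Rep_hs (X m)) a))\<^sup>2) \<le> e\<^sup>2" by blast
  qed
  have sm: "hilbert_schmidt (Rep_hs (X n) - T)"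
    if N: "\<forall>m\<ge>N. \<forall>n\<ge>N. dist (X m) (X n) < e" and n: "N \<le> n" for e N n
    unfolding hilbert_schmidt_def
    using fin[OF that] by (intro nonneg_bdd_above_summable_on) (auto intro!: bdd_aboveI2[where M="e\<^sup>2"])
  obtain N1 where N1: "\<forall>m\<ge>N1. \<forall>n\<ge>N1. dist (X m) (X n) < 1"
    using metric_CauchyD[OF X, of 1] by auto
  have "hilbert_schmidt (Rep_hs (X N1) - (Rep_hs (X N1) - T))"
    by (rule hilbert_schmidt_diff[OF _ sm[OF N1 order_refl]]) (use Rep_hs[of "X N1"] in simp)
  moreover have "Rep_hs (X N1) - (Rep_hs (X N1) - T) = T" by (simp add: algebra_simps)
  ultimately have hT: "hilbert_schmidt T" by metis
  have "X \<longlonglongrightarrow> Abs_hs T"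
  proof (rule metric_LIMSEQ_I)
    fix r :: real assume r: "0 < r"
    then obtain N where N: "\<forall>m\<ge>N. \<forall>n\<ge>N. dist (X m) (X n) < r/2"
      using metric_CauchyD[OF X, of "r/2"] by auto
    have "dist (X n) (Abs_hs T) < r" if n: "N \<le> n" for n
    proof -
      have rep: "Rep_hs (X n - Abs_hs T) = Rep_hs (X n) - T"
        using hT by (simp add: minus_hs.rep_eq Abs_hs_inverse)
      have "(norm (X n - Abs_hs T))\<^sup>2 \<le> (r/2)\<^sup>2"
        unfolding hs_norm_square rep
        using sm[OF N n] fin[OF N n] by (intro infsum_le_finite_sums) (auto simp: hilbert_schmidt_def)
      hence "norm (X n - Abs_hs T) \<le> r/2" by (rule power2_le_imp_le) (use r in simp)
      thus ?thesis using r by (simp add: dist_norm)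
    qed
    thus "\<exists>N. \<forall>n\<ge>N. dist (X n) (Abs_hs T) < r" by blast
  qed
  thus "convergent X" by (auto simp: convergent_def)
qed

text \<open>The Hilbert-Schmidt norm of an arbitrary bounded operator, infinite off the
  Hilbert-Schmidt class.\<close>

definition hs_norm :: "('h::{real_inner,banach} \<Rightarrow>\<^sub>L 'h) \<Rightarrow> ennreal" where
  "hs_norm A = (if hilbert_schmidt A then ennreal (norm (Abs_hs A)) else \<infinity>)"

section \<open>Square roots and trace class operators\<close>

definition blinfun_adjoint :: "('h::{real_inner,banach} \<Rightarrow>\<^sub>L 'h) \<Rightarrow> ('h \<Rightarrow>\<^sub>L 'h)" where
  "blinfun_adjoint A = Blinfun (adjoint (blinfun_apply A))"

definition nonneg_definite :: "('h::{real_inner,banach} \<Rightarrow>\<^sub>L 'h) \<Rightarrow> bool" where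
  "nonneg_definite A \<longleftrightarrow> (\<forall>x y. inner (A x) y = inner x (A y)) \<and> (\<forall>x. 0 \<le> inner (A x) x)"

definition op_sqrt :: "('h::{real_inner,banach} \<Rightarrow>\<^sub>L 'h) \<Rightarrow> ('h \<Rightarrow>\<^sub>L 'h)" where
  "op_sqrt A = (THE R. nonneg_definite R \<and> R o\<^sub>L R = A)"

definition compact_operator :: "('h::{real_inner,banach} \<Rightarrow>\<^sub>L 'h) \<Rightarrow> bool" where
  "compact_operator A \<longleftrightarrow> compact (closure (blinfun_apply A ` cball 0 1))"

definition trace_norm :: "('h::{real_inner,banach} \<Rightarrow>\<^sub>L 'h) \<Rightarrow> ennreal" where
  "trace_norm A = (hs_norm (op_sqrt (op_sqrt (blinfun_adjoint A o\<^sub>L A))))\<^sup>2"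

definition trace_class :: "('h::{real_inner,banach} \<Rightarrow>\<^sub>L 'h) \<Rightarrow> bool" where
  "trace_class A \<longleftrightarrow> compact_operator A \<and> trace_norm A < \<infinity>"

text \<open>
  Trace class operators are Hilbert-Schmidt, so a bounded operator on the Hilbert-Schmidt
  operators may restrict to a bounded operator on the space of trace class operators with the
  trace norm; its operator norm there is formed as in \<^const>\<open>onorm\<close>.
\<close>

definition bounded_on_trace_class :: "('h::{real_inner,banach} hs \<Rightarrow>\<^sub>L 'h hs) \<Rightarrow> bool" where
  "bounded_on_trace_class C \<longleftrightarrow>
     (\<forall>A. trace_class (Rep_hs A) \<longrightarrow> trace_class (Rep_hs (C A))) \<and>
     (\<exists>K::real. \<forall>A. trace_class (Rep_hs A) \<longrightarrow>
        enn2real (trace_norm (Rep_hs (C A))) \<le> K * enn2real (trace_norm (Rep_hs A)))"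

definition trace_class_onorm :: "('h::{real_inner,banach} hs \<Rightarrow>\<^sub>L 'h hs) \<Rightarrow> real" where
  "trace_class_onorm C =
     (SUP A\<in>{A. trace_class (Rep_hs A)}.
        enn2real (trace_norm (Rep_hs (C A))) / enn2real (trace_norm (Rep_hs A)))"

section \<open>Compound Poisson processes and the variance process\<close>

definition poisson_process :: "'w measure \<Rightarrow> real \<Rightarrow> (real \<Rightarrow> 'w \<Rightarrow> nat) \<Rightarrow> bool" where
  "poisson_process M rate N \<longleftrightarrow>
     (\<forall>t\<ge>0. N t \<in> measurable M (count_space UNIV)) \<and>
     (AE \<omega> in M. N 0 \<omega> = 0 \<and> mono_on {0..} (\<lambda>t. N t \<omega>) \<and>
        (\<forall>t\<ge>0. continuous (at_right t) (\<lambda>s. N s \<omega>))) \<and>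
     (\<forall>s t. 0 \<le> s \<and> s < t \<longrightarrow>
        distr M (count_space UNIV) (\<lambda>\<omega>. N t \<omega> - N s \<omega>) = measure_pmf (poisson_pmf (rate * (t - s)))) \<and>
     (\<forall>(\<tau> :: nat \<Rightarrow> real) n. 0 \<le> \<tau> 0 \<and> mono \<tau> \<longrightarrow>
        prob_space.indep_vars M (\<lambda>_. count_space UNIV)
          (\<lambda>i \<omega>. N (\<tau> (Suc i)) \<omega> - N (\<tau> i) \<omega>) {..<n})"

definition iid_sequence :: "'w measure \<Rightarrow> (nat \<Rightarrow> 'w \<Rightarrow> 'b::topological_space) \<Rightarrow> bool" where
  "iid_sequence M X \<longleftrightarrow>
     prob_space.indep_vars M (\<lambda>_. borel) X {1..} \<and>
     (\<forall>i\<ge>1. distr M borel (X i) = distr M borel (X 1))"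

text \<open>Independence of the whole process \<open>N\<close> from the whole sequence \<open>X\<close>, as independence of
  the generated sigma-algebras.\<close>

definition process_indep_sequence ::
    "'w measure \<Rightarrow> (real \<Rightarrow> 'w \<Rightarrow> nat) \<Rightarrow> (nat \<Rightarrow> 'w \<Rightarrow> 'b::topological_space) \<Rightarrow> bool" where
  "process_indep_sequence M N X \<longleftrightarrow>
     prob_space.indep_set M
       (sets (vimage_algebra (space M) (\<lambda>\<omega>. \<lambda>t\<in>{0..}. N t \<omega>) (\<Pi>\<^sub>M t\<in>{0..}. count_space UNIV)))
       (sets (vimage_algebra (space M) (\<lambda>\<omega>. \<lambda>i\<in>{1..}. X i \<omega>) (\<Pi>\<^sub>M i\<in>{1..}. borel)))"

definition compound_poisson ::
    "(real \<Rightarrow> 'w \<Rightarrow> nat) \<Rightarrow> (nat \<Rightarrow> 'w \<Rightarrow> 'b::comm_monoid_add) \<Rightarrow> real \<Rightarrow> 'w \<Rightarrow> 'b" where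
  "compound_poisson N X t \<omega> = (\<Sum>i=1..N t \<omega>. X i \<omega>)"

text \<open>\<open>V\<close> solves \<open>dV(t) = C V(t) dt + dL(t)\<close>, \<open>V(0) = V\<^sub>0\<close>, that is, almost surely
  \<open>V(t) = V\<^sub>0 + \<integral>\<^sub>0\<^sup>t C V(s) ds + L(t)\<close> for all \<open>t \<ge> 0\<close>.\<close>

definition variance_process ::
    "'w measure \<Rightarrow> ('b::real_normed_vector \<Rightarrow>\<^sub>L 'b) \<Rightarrow> ('w \<Rightarrow> 'b) \<Rightarrow> (real \<Rightarrow> 'w \<Rightarrow> 'b) \<Rightarrow> (real \<Rightarrow> 'w \<Rightarrow> 'b) \<Rightarrow> bool" where
  "variance_process M C V0 L V \<longleftrightarrow>
     (\<forall>t\<ge>0. V t \<in> borel_measurable M) \<and>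
     (AE \<omega> in M. \<forall>t\<ge>0.
        ((\<lambda>s. C (V s \<omega>)) has_integral (V t \<omega> - V0 \<omega> - L t \<omega>)) {0..t})"

end

theory Submission
  imports Defs
begin

text \<open>
  For a fixed outcome, let \<open>V\<close> and \<open>W\<close> solve the two linear equations with operators
  \<open>C\<close> and \<open>D\<close> and the same data. Square roots are compared through the Powers-Stormer
  inequality
  \<open>\<parallel>\<surd>V - \<surd>W\<parallel>\<^sub>H\<^sub>S\<^sup>2 \<le> \<parallel>V - W\<parallel>\<^sub>1\<close>
  (\<open>powers_stormer\<close>), which removes the square roots, so it remains to bound \<open>V - W\<close> in trace
  norm. Operator norms being taken with respect to the trace norm, write \<open>c\<close> for the larger of those of
  \<open>C\<close> and \<open>D\<close>, \<open>\<delta>\<close> for that of \<open>C - D\<close> and \<open>k\<close>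
  for \<open>\<parallel>V(0)\<parallel>\<^sub>1\<close> plus the sum of the
  \<open>\<parallel>X\<^sub>i\<parallel>\<^sub>1\<close> over the jumps up to \<open>T\<close>, the equation for
  \<open>V\<close> gives \<open>\<parallel>V(t)\<parallel>\<^sub>1 \<le> k e\<^bsup>ct\<^esup>\<close>. The difference
  satisfies
  \<open>(V - W)(t) = \<integral>\<^sub>0\<^sup>t (C - D) V(s) ds + \<integral>\<^sub>0\<^sup>t D (V - W)(s) ds\<close>,
  whence \<open>\<parallel>(V - W)(t)\<parallel>\<^sub>1 \<le> \<delta> k t e\<^bsup>ct\<^esup>\<close>
  (\<open>variance_path_distance\<close>). Taking expectations, independence of the jump sizes from the Poisson process
  turns the expectation of \<open>k\<close> into the mean initial trace norm plus \<open>\<lambda>T\<close> times the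
  mean trace norm of a jump (\<open>compound_poisson_mean\<close>), and the constant of the theorem can be taken to be
  \<open>1\<close>.

  The integrals converge in the Hilbert-Schmidt norm only, and the solutions are not known in advance to be continuous
  in trace norm. What makes the estimates possible all the same is that the trace norm is the norm dual to the operator
  norm: \<open>\<parallel>A\<parallel>\<^sub>1\<close> is the supremum of the Hilbert-Schmidt inner products of
  \<open>A\<close> with contractions \<open>K\<close> (\<open>inner_le_trace_norm\<close>,
  \<open>trace_norm_le_dual\<close>). As a supremum of functionals that are continuous in the Hilbert-Schmidt norm, it
  is subadditive, can be pulled under integrals, is Borel measurable, and has sublevel sets closed under Hilbert-Schmidt
  limits. The last property lets Gronwall's lemma pass from the Picard iterates to the solution
  (\<open>trace_norm_gronwall\<close>).

  The operator theory behind the duality rests on the spectral theorem for compact symmetric operators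
  (\<open>compact_spectral_theorem\<close>). In an eigenbasis square roots are diagonal, so \<open>op_sqrt\<close> is
  well defined and the trace norm becomes the sum of the singular values.
\<close>

section \<open>Orthonormal bases of a Hilbert space\<close>

lemma orthonormal_inner:
  assumes "orthonormal B" "e \<in> B" "f \<in> B"
  shows "inner e f = (if e = f then 1 else 0)"
  using assms by (auto simp: orthonormal_def pairwise_def orthogonal_def norm_eq_1)

lemma norm_orthogonal_sum:
  fixes g :: "'i \<Rightarrow> 'h::real_inner"
  assumes "finite F" "\<And>e f. e \<in> F \<Longrightarrow> f \<in> F \<Longrightarrow> e \<noteq> f \<Longrightarrow> inner (g e) (g f) = 0"
  shows "(norm (\<Sum>e\<in>F. c e *\<^sub>R g e))\<^sup>2 = (\<Sum>e\<in>F. (c e)\<^sup>2 * (norm (g e))\<^sup>2)"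
proof -
  have "(norm (\<Sum>e\<in>F. c e *\<^sub>R g e))\<^sup>2 = (\<Sum>e\<in>F. \<Sum>f\<in>F. c f * (c e * inner (g e) (g f)))"
    unfolding power2_norm_eq_inner by (simp add: inner_sum_left inner_sum_right sum_distrib_left inner_commute)
  also have "\<dots> = (\<Sum>e\<in>F. \<Sum>f\<in>F. if e = f then (c e)\<^sup>2 * (norm (g e))\<^sup>2 else 0)"
    by (intro sum.cong refl) (auto simp: assms(2) power2_eq_square power2_norm_eq_inner[symmetric])
  also have "\<dots> = (\<Sum>e\<in>F. (c e)\<^sup>2 * (norm (g e))\<^sup>2)" using assms(1) by simp
  finally show ?thesis .
qed

lemma norm_orthonormal_sum:
  assumes "orthonormal B" "finite F" "F \<subseteq> B"
  shows "(norm (\<Sum>e\<in>F. c e *\<^sub>R e))\<^sup>2 = (\<Sum>e\<in>F. (c e)\<^sup>2)"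
proof -
  have "inner e f = 0" if "e \<in> F" "f \<in> F" "e \<noteq> f" for e f
    using orthonormal_inner[OF assms(1), of e f] that assms(3) by auto
  hence "(norm (\<Sum>e\<in>F. c e *\<^sub>R e))\<^sup>2 = (\<Sum>e\<in>F. (c e)\<^sup>2 * (norm e)\<^sup>2)"
    by (rule norm_orthogonal_sum[OF assms(2)])
  also have "\<dots> = (\<Sum>e\<in>F. (c e)\<^sup>2)"
    using assms by (intro sum.cong) (auto simp: orthonormal_def subset_iff)
  finally show ?thesis .
qed

text \<open>
  Completing the square: among all combinations of \<open>F\<close> the Fourier coefficients give the best approximation
  of \<open>x\<close>. Both Bessel's inequality and the basis expansion are read off from this identity.
\<close>

lemma projection_error:
  assumes "orthonormal B" "finite F" "F \<subseteq> B"
  shows "(norm (x - (\<Sum>e\<in>F. c e *\<^sub>R e)))\<^sup>2 = (norm x)\<^sup>2 - (\<Sum>e\<in>F. (inner x e)\<^sup>2) + (\<Sum>e\<in>F. (c e - inner x e)\<^sup>2)"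
proof -
  have "(norm (x - (\<Sum>e\<in>F. c e *\<^sub>R e)))\<^sup>2 = (norm x)\<^sup>2 - 2 * inner x (\<Sum>e\<in>F. c e *\<^sub>R e) + (norm (\<Sum>e\<in>F. c e *\<^sub>R e))\<^sup>2"
    unfolding power2_norm_eq_inner inner_diff_left inner_diff_right
    using inner_commute[of x "\<Sum>e\<in>F. c e *\<^sub>R e"] by linarith
  also have "inner x (\<Sum>e\<in>F. c e *\<^sub>R e) = (\<Sum>e\<in>F. c e * inner x e)"
    by (simp add: inner_sum_right)
  also have "(norm (\<Sum>e\<in>F. c e *\<^sub>R e))\<^sup>2 = (\<Sum>e\<in>F. (c e)\<^sup>2)"
    by (rule norm_orthonormal_sum[OF assms])
  finally show ?thesis
    by (simp add: power2_diff sum.distrib sum_subtractf sum_distrib_left mult.assoc)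
qed

lemma bessel:
  assumes "orthonormal B" "finite F" "F \<subseteq> B"
  shows "(\<Sum>e\<in>F. (inner x e)\<^sup>2) \<le> (norm x)\<^sup>2"
  using projection_error[OF assms, of x "\<lambda>e. inner x e"]
    zero_le_power2[of "norm (x - (\<Sum>e\<in>F. inner x e *\<^sub>R e))"] by simp

text \<open>
  By density some finite combination of basis vectors is within \<open>d\<close> of \<open>x\<close>, and for every
  larger finite set of basis vectors the Fourier sum is at least as good as that combination.
\<close>

lemma has_sum_basis_expansion:
  assumes "orthonormal_basis B"
  shows "((\<lambda>e. inner x e *\<^sub>R e) has_sum x) B"
  unfolding has_sum_def
proof (rule tendstoI)
  fix d :: real assume d: "0 < d"
  have o: "orthonormal B" and "x \<in> closure (span B)" using assms by (auto simp: orthonormal_basis_def)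
  then obtain s where s: "s \<in> span B" "dist s x < d"
    using closure_approachable d by blast
  from s(1) obtain F c where F: "finite F" "F \<subseteq> B" and sF: "s = (\<Sum>e\<in>F. c e *\<^sub>R e)"
    unfolding span_explicit by blast
  have "dist (\<Sum>e\<in>G. inner x e *\<^sub>R e) x < d" if G: "finite G" "F \<subseteq> G" "G \<subseteq> B" for G
  proof -
    \<comment> \<open>The combination \<open>s\<close>, viewed as one over the larger set \<open>G\<close>, competes with the Fourier sum.\<close>
    define c' where "c' e = (if e \<in> F then c e else 0)" for e
    have "s = (\<Sum>e\<in>G. c' e *\<^sub>R e)" unfolding sF c'_def
      using G by (intro sum.mono_neutral_cong_left) auto
    hence "(norm (x - s))\<^sup>2 \<ge> (norm (x - (\<Sum>e\<in>G. inner x e *\<^sub>R e)))\<^sup>2"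
      using projection_error[OF o G(1,3), of x c'] projection_error[OF o G(1,3), of x "\<lambda>e. inner x e"]
      by (simp add: sum_nonneg)
    hence "norm (x - (\<Sum>e\<in>G. inner x e *\<^sub>R e)) \<le> norm (x - s)"
      by (rule power2_le_imp_le) simp
    thus ?thesis using s(2) by (simp add: dist_norm norm_minus_commute)
  qed
  thus "\<forall>\<^sub>F G in finite_subsets_at_top B. dist (\<Sum>e\<in>G. inner x e *\<^sub>R e) x < d"
    unfolding eventually_finite_subsets_at_top using F by blast
qed

lemma has_sum_parseval:
  assumes "orthonormal_basis B"
  shows "((\<lambda>e. (inner x e)\<^sup>2) has_sum (norm x)\<^sup>2) B"
  using has_sum_bounded_linear[OF bounded_linear_inner_right[of x] has_sum_basis_expansion[OF assms, of x]]
  unfolding power2_norm_eq_inner by (simp add: power2_eq_square)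

text \<open>
  By Pythagoras the Cauchy condition for the vectors is that of the squared coefficients.
\<close>

lemma summable_orthonormal_series:
  fixes B :: "'h::{real_inner,banach} set"
  assumes o: "orthonormal B" and c: "(\<lambda>e. (c e)\<^sup>2) summable_on B"
  shows "(\<lambda>e. c e *\<^sub>R e) summable_on B"
proof -
  have "\<exists>P. eventually P (finite_subsets_at_top B) \<and>
      (\<forall>F G. P F \<and> P G \<longrightarrow> dist (\<Sum>e\<in>F. c e *\<^sub>R e) (\<Sum>e\<in>G. c e *\<^sub>R e) < d)" if d: "0 < d" for d
  proof -
    have "((\<lambda>e. (c e)\<^sup>2) has_sum (\<Sum>\<^sub>\<infinity>e\<in>B. (c e)\<^sup>2)) B" using c by (rule has_sum_infsum)
    moreover have "0 < (d/2)\<^sup>2 / 2" using d by simp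
    ultimately have "\<forall>\<^sub>F F in finite_subsets_at_top B. dist (\<Sum>e\<in>F. (c e)\<^sup>2) (\<Sum>\<^sub>\<infinity>e\<in>B. (c e)\<^sup>2) < (d/2)\<^sup>2 / 2"
      unfolding has_sum_def by (rule tendstoD)
    then obtain F0 where F0': "finite F0 \<and> F0 \<subseteq> B \<and> (\<forall>F. finite F \<and> F0 \<subseteq> F \<and> F \<subseteq> B \<longrightarrow>
        dist (\<Sum>e\<in>F. (c e)\<^sup>2) (\<Sum>\<^sub>\<infinity>e\<in>B. (c e)\<^sup>2) < (d/2)\<^sup>2 / 2)"
      unfolding eventually_finite_subsets_at_top ..
    have F0: "finite F0" "F0 \<subseteq> B" using F0' by auto
    have *: "dist (\<Sum>e\<in>F. (c e)\<^sup>2) (\<Sum>\<^sub>\<infinity>e\<in>B. (c e)\<^sup>2) < (d/2)\<^sup>2 / 2"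
      if "finite F" "F0 \<subseteq> F" "F \<subseteq> B" for F using F0' that by blast
    have tail: "dist (\<Sum>e\<in>F. c e *\<^sub>R e) (\<Sum>e\<in>F0. c e *\<^sub>R e) < d/2" if F: "finite F" "F0 \<subseteq> F" "F \<subseteq> B" for F
    proof -
      have "(norm ((\<Sum>e\<in>F. c e *\<^sub>R e) - (\<Sum>e\<in>F0. c e *\<^sub>R e)))\<^sup>2 = (norm (\<Sum>e\<in>F-F0. c e *\<^sub>R e))\<^sup>2"
        using F by (simp add: sum_diff)
      also have "\<dots> = (\<Sum>e\<in>F-F0. (c e)\<^sup>2)" using F by (intro norm_orthonormal_sum[OF o]) auto
      also have "\<dots> = (\<Sum>e\<in>F. (c e)\<^sup>2) - (\<Sum>e\<in>F0. (c e)\<^sup>2)" using F by (simp add: sum_diff)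
      also have "\<dots> < (d/2)\<^sup>2"
        using *[OF F] *[OF F0(1) order_refl F0(2)] unfolding dist_real_def by linarith
      finally show ?thesis unfolding dist_norm by (rule power_less_imp_less_base) (use d in simp)
    qed
    show ?thesis
    proof (intro exI[of _ "\<lambda>F. finite F \<and> F0 \<subseteq> F \<and> F \<subseteq> B"] conjI allI impI)
      show "\<forall>\<^sub>F F in finite_subsets_at_top B. finite F \<and> F0 \<subseteq> F \<and> F \<subseteq> B"
        unfolding eventually_finite_subsets_at_top using F0 by blast
      fix F G assume "(finite F \<and> F0 \<subseteq> F \<and> F \<subseteq> B) \<and> (finite G \<and> F0 \<subseteq> G \<and> G \<subseteq> B)"
      thus "dist (\<Sum>e\<in>F. c e *\<^sub>R e) (\<Sum>e\<in>G. c e *\<^sub>R e) < d"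
        using dist_triangle_half_l[OF tail tail] by blast
    qed
  qed
  hence "cauchy_filter (filtermap (sum (\<lambda>e. c e *\<^sub>R e)) (finite_subsets_at_top B))"
    by (simp add: cauchy_filter_metric_filtermap)
  moreover have "Topological_Spaces.complete (UNIV::'h set)"
    by (meson Cauchy_convergent UNIV_I complete_def convergent_def)
  ultimately obtain L where "(sum (\<lambda>e. c e *\<^sub>R e) \<longlongrightarrow> L) (finite_subsets_at_top B)"
    using complete_uniform[where S=UNIV] by (force simp add: filterlim_def)
  thus ?thesis using summable_on_def has_sum_def by blast
qed

lemma inner_orthonormal_series:
  fixes B :: "'h::{real_inner,banach} set"
  assumes o: "orthonormal B" and c: "(\<lambda>e. (c e)\<^sup>2) summable_on B"
  shows "((\<lambda>e. c e * inner e x) has_sum inner (\<Sum>\<^sub>\<infinity>e\<in>B. c e *\<^sub>R e) x) B"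
  using has_sum_bounded_linear[OF bounded_linear_inner_left has_sum_infsum[OF summable_orthonormal_series[OF assms]], of x]
  by simp

lemma inner_orthonormal_series_basis:
  fixes B :: "'h::{real_inner,banach} set"
  assumes o: "orthonormal B" and c: "(\<lambda>e. (c e)\<^sup>2) summable_on B" and f: "f \<in> B"
  shows "inner (\<Sum>\<^sub>\<infinity>e\<in>B. c e *\<^sub>R e) f = c f"
proof -
  have "((\<lambda>e. if e = f then c f else 0) has_sum inner (\<Sum>\<^sub>\<infinity>e\<in>B. c e *\<^sub>R e) f) B"
    using inner_orthonormal_series[OF o c, of f]
    by (rule has_sum_cong[THEN iffD1, rotated]) (simp add: orthonormal_inner[OF o _ f])
  moreover have "((\<lambda>e. if e = f then c f else 0) has_sum c f) B"
    using f by (subst has_sum_cong_neutral[where T="{f}" and g="\<lambda>_. c f"]) (auto intro: has_sum_finiteI)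
  ultimately show ?thesis by (rule has_sum_unique)
qed

lemma basis_inner_eqI:
  assumes "orthonormal_basis B" "\<And>e. e \<in> B \<Longrightarrow> inner x e = inner y e"
  shows "x = y"
proof -
  have "((\<lambda>e. inner x e *\<^sub>R e) has_sum y) B"
    using has_sum_basis_expansion[OF assms(1), of y]
    by (rule has_sum_cong[THEN iffD1, rotated]) (simp add: assms(2))
  thus ?thesis using has_sum_basis_expansion[OF assms(1), of x] has_sum_unique by blast
qed

lemma blinfun_eq_on_basis:
  fixes A A' :: "'h::real_inner \<Rightarrow>\<^sub>L 'k::real_normed_vector"
  assumes "orthonormal_basis B" "\<And>e. e \<in> B \<Longrightarrow> A e = A' e"
  shows "A = A'"
proof (rule blinfun_eqI)
  fix x
  have A: "((\<lambda>e. A (inner x e *\<^sub>R e)) has_sum A x) B" and A': "((\<lambda>e. A' (inner x e *\<^sub>R e)) has_sum A' x) B"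
    by (rule has_sum_bounded_linear[OF blinfun.bounded_linear_right has_sum_basis_expansion[OF assms(1)]])+
  from A have "((\<lambda>e. A' (inner x e *\<^sub>R e)) has_sum A x) B"
    by (rule has_sum_cong[THEN iffD1, rotated]) (simp add: assms(2) blinfun.scaleR_right)
  thus "A x = A' x" using A' has_sum_unique by blast
qed

text \<open>
  The source of square roots: the eigenvalues of a square root are prescribed, and this lemma turns them into an
  operator.
\<close>

lemma diagonal_operator_exists:
  fixes B :: "'h::{real_inner,banach} set"
  assumes B: "orthonormal_basis B" and s: "\<And>e. e \<in> B \<Longrightarrow> 0 \<le> s e \<and> s e \<le> M"
  shows "\<exists>D. nonneg_definite D \<and> (\<forall>e\<in>B. D e = s e *\<^sub>R e)"
proof -
  have o: "orthonormal B" using B by (simp add: orthonormal_basis_def)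
  have le: "(s e * inner x e)\<^sup>2 \<le> M\<^sup>2 * (inner x e)\<^sup>2" if "e \<in> B" for e x
    using s[OF that] by (simp add: power_mult_distrib mult_right_mono power_mono)
  have ps: "(\<lambda>e. M\<^sup>2 * (inner x e)\<^sup>2) summable_on B" for x
    using has_sum_parseval[OF B, of x] by (intro summable_on_cmult_right) (auto simp: summable_on_def)
  have sm: "(\<lambda>e. (s e * inner x e)\<^sup>2) summable_on B" for x
    by (rule summable_on_comparison_test[OF ps]) (use le in auto)
  define D where "D x = (\<Sum>\<^sub>\<infinity>e\<in>B. (s e * inner x e) *\<^sub>R e)" for x
  have Di: "inner (D x) f = s f * inner x f" if "f \<in> B" for x f
    unfolding D_def by (rule inner_orthonormal_series_basis[OF o sm that])
  have bl: "bounded_linear D"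
  proof (rule bounded_linear_intro[where K="\<bar>M\<bar>"])
    show "D (x + y) = D x + D y" for x y
      by (rule basis_inner_eqI[OF B]) (simp add: Di inner_add_left algebra_simps)
    show "D (r *\<^sub>R x) = r *\<^sub>R D x" for x r
      by (rule basis_inner_eqI[OF B]) (simp add: Di)
    show "norm (D x) \<le> norm x * \<bar>M\<bar>" for x
    proof (rule power2_le_imp_le)
      have "(norm (D x))\<^sup>2 \<le> M\<^sup>2 * (norm x)\<^sup>2"
      proof (rule has_sum_mono[OF has_sum_parseval[OF B]])
        show "((\<lambda>e. M\<^sup>2 * (inner x e)\<^sup>2) has_sum M\<^sup>2 * (norm x)\<^sup>2) B"
          by (intro has_sum_cmult_right has_sum_parseval[OF B])
      qed (use le Di in auto)
      thus "(norm (D x))\<^sup>2 \<le> (norm x * \<bar>M\<bar>)\<^sup>2" by (simp add: power_mult_distrib mult.commute)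
    qed simp
  qed
  have ap: "blinfun_apply (Blinfun D) = D" by (rule bounded_linear_Blinfun_apply[OF bl])
  have in_D: "((\<lambda>e. s e * inner x e * inner e y) has_sum inner (D x) y) B" for x y
    unfolding D_def by (rule inner_orthonormal_series[OF o sm])
  have "inner (D x) y = inner x (D y)" for x y
  proof -
    have "((\<lambda>e. s e * inner y e * inner e x) has_sum inner (D x) y) B"
      using in_D[of x y] by (simp add: inner_commute mult_ac)
    thus ?thesis using in_D[of y x] has_sum_unique by (metis inner_commute)
  qed
  moreover have "0 \<le> inner (D x) x" for x
    using in_D[of x x] by (rule has_sum_nonneg) (use s in \<open>auto simp: inner_commute mult.assoc\<close>)
  moreover have "D f = s f *\<^sub>R f" if "f \<in> B" for f
    by (rule basis_inner_eqI[OF B]) (use that in \<open>auto simp: Di orthonormal_inner[OF o]\<close>)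
  ultimately show ?thesis by (intro exI[of _ "Blinfun D"]) (simp add: nonneg_definite_def ap)
qed

section \<open>Hilbert-Schmidt operators\<close>

lemma has_sum_finite_sum:
  fixes f :: "'i \<Rightarrow> 'a \<Rightarrow> 'b::topological_comm_monoid_add"
  assumes "\<And>i. i \<in> I \<Longrightarrow> (f i has_sum s i) A"
  shows "((\<lambda>x. \<Sum>i\<in>I. f i x) has_sum (\<Sum>i\<in>I. s i)) A"
  using assms by (induction I rule: infinite_finite_induct) (auto intro!: has_sum_add)

text \<open>
  Expand each \<open>A f\<close> by Parseval in \<open>B'\<close>, interchange the finite sum over \<open>F\<close> with
  the series, and apply Bessel to \<open>A' e\<close>. Restricting to finite \<open>F\<close> avoids any interchange of
  two infinite sums.
\<close>

lemma sum_norm_adjoint_le: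
  fixes A A' :: "'h::{real_inner,banach} \<Rightarrow>\<^sub>L 'h"
  assumes B: "orthonormal_basis B" and B': "orthonormal_basis B'"
    and adj: "\<And>x y. inner (A x) y = inner x (A' y)"
    and S: "((\<lambda>e. (norm (A' e))\<^sup>2) has_sum S) B'"
    and F: "finite F" "F \<subseteq> B"
  shows "(\<Sum>f\<in>F. (norm (A f))\<^sup>2) \<le> S"
proof -
  have "((\<lambda>e. \<Sum>f\<in>F. (inner (A f) e)\<^sup>2) has_sum (\<Sum>f\<in>F. (norm (A f))\<^sup>2)) B'"
    by (intro has_sum_finite_sum has_sum_parseval[OF B'])
  moreover note S
  moreover have "(\<Sum>f\<in>F. (inner (A f) e)\<^sup>2) \<le> (norm (A' e))\<^sup>2" for e
    using bessel[OF _ F, of "A' e"] B by (simp add: adj inner_commute[of "A' e"] orthonormal_basis_def)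
  ultimately show ?thesis by (rule has_sum_mono)
qed

lemma has_sum_norm_adjoint_le:
  fixes A A' :: "'h::{real_inner,banach} \<Rightarrow>\<^sub>L 'h"
  assumes B: "orthonormal_basis B" and B': "orthonormal_basis B'"
    and adj: "\<And>x y. inner (A x) y = inner x (A' y)"
    and S: "((\<lambda>e. (norm (A' e))\<^sup>2) has_sum S) B'"
  obtains S' where "((\<lambda>f. (norm (A f))\<^sup>2) has_sum S') B" "S' \<le> S"
proof -
  note le = sum_norm_adjoint_le[OF B B' adj S]
  have sm: "(\<lambda>f. (norm (A f))\<^sup>2) summable_on B"
    by (rule nonneg_bdd_above_summable_on) (auto intro!: bdd_aboveI2[where M=S] le)
  show thesis
    by (rule that[OF has_sum_infsum[OF sm]], rule infsum_le_finite_sums[OF sm]) (use le in auto)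
qed

text \<open>
  Passing to the adjoint and back compares the sums over \<open>B\<close> and \<open>B'\<close> in both directions,
  through the chain \<open>S \<ge> S1 \<ge> S2 \<ge> S3 \<ge> S4 = S\<close>.
\<close>

lemma has_sum_norm_basis_change:
  fixes A A' :: "'h::{real_inner,banach} \<Rightarrow>\<^sub>L 'h"
  assumes B: "orthonormal_basis B" and B': "orthonormal_basis B'"
    and adj: "\<And>x y. inner (A x) y = inner x (A' y)"
    and S: "((\<lambda>e. (norm (A e))\<^sup>2) has_sum S) B"
  shows "((\<lambda>e. (norm (A e))\<^sup>2) has_sum S) B'"
proof -
  have adj': "inner (A' x) y = inner x (A y)" for x y by (metis adj inner_commute)
  obtain S1 where S1: "((\<lambda>f. (norm (A' f))\<^sup>2) has_sum S1) B" "S1 \<le> S"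
    using has_sum_norm_adjoint_le[OF B B adj' S] .
  obtain S2 where S2: "((\<lambda>f. (norm (A f))\<^sup>2) has_sum S2) B'" "S2 \<le> S1"
    using has_sum_norm_adjoint_le[OF B' B adj S1(1)] .
  obtain S3 where S3: "((\<lambda>f. (norm (A' f))\<^sup>2) has_sum S3) B'" "S3 \<le> S2"
    using has_sum_norm_adjoint_le[OF B' B' adj' S2(1)] .
  obtain S4 where S4: "((\<lambda>f. (norm (A f))\<^sup>2) has_sum S4) B" "S4 \<le> S3"
    using has_sum_norm_adjoint_le[OF B B' adj S3(1)] .
  have "S4 = S" using S4(1) S has_sum_unique by blast
  hence "S2 = S" using S1 S2 S3 S4 by linarith
  thus ?thesis using S2 by simp
qed

text \<open>
  The adjoint is given by the series of the \<open>(inner (A e) y) *\<^sub>R e\<close> over the basis, whose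
  coefficients are square summable because \<open>A\<close> is Hilbert-Schmidt.
\<close>

lemma hilbert_schmidt_adjoint_exists:
  fixes A :: "'h::{real_inner,banach} \<Rightarrow>\<^sub>L 'h"
  assumes A: "hilbert_schmidt A"
  obtains A' :: "'h \<Rightarrow>\<^sub>L 'h" where "\<And>x y. inner (A x) y = inner x (A' y)"
proof -
  have B: "orthonormal_basis (onb :: 'h set)" by (rule orthonormal_basis_onb)
  hence o: "orthonormal (onb :: 'h set)" by (simp add: orthonormal_basis_def)
  define K where "K = (\<Sum>\<^sub>\<infinity>e\<in>onb. (norm (A e))\<^sup>2)"
  have K: "((\<lambda>e. (norm (A e))\<^sup>2) has_sum K) onb"
    unfolding K_def using A unfolding hilbert_schmidt_def by (rule has_sum_infsum)
  have K0: "0 \<le> K" using K by (rule has_sum_nonneg) simp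
  have Ky: "((\<lambda>e. (norm (A e))\<^sup>2 * (norm y)\<^sup>2) has_sum K * (norm y)\<^sup>2) onb" for y
    by (intro has_sum_cmult_left K)
  have le: "(inner (A e) y)\<^sup>2 \<le> (norm (A e))\<^sup>2 * (norm y)\<^sup>2" for e y
    using Cauchy_Schwarz_ineq[of "A e" y] by (simp add: power2_norm_eq_inner)
  have sm: "(\<lambda>e. (inner (A e) y)\<^sup>2) summable_on onb" for y
    using Ky[of y] by (intro summable_on_comparison_test[OF _ le]) (auto simp: summable_on_def)
  define D where "D y = (\<Sum>\<^sub>\<infinity>e\<in>onb. inner (A e) y *\<^sub>R e)" for y
  have Di: "inner (D y) f = inner (A f) y" if "f \<in> onb" for y f
    unfolding D_def by (rule inner_orthonormal_series_basis[OF o sm that])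
  have bl: "bounded_linear D"
  proof (rule bounded_linear_intro[where K="sqrt K"])
    show "D (x + y) = D x + D y" for x y
      by (rule basis_inner_eqI[OF B]) (simp add: Di inner_add_left inner_add_right)
    show "D (r *\<^sub>R x) = r *\<^sub>R D x" for x r
      by (rule basis_inner_eqI[OF B]) (simp add: Di)
    show "norm (D x) \<le> norm x * sqrt K" for x
    proof (rule power2_le_imp_le)
      have "(norm (D x))\<^sup>2 \<le> K * (norm x)\<^sup>2"
        by (rule has_sum_mono[OF has_sum_parseval[OF B] Ky]) (use le Di in auto)
      thus "(norm (D x))\<^sup>2 \<le> (norm x * sqrt K)\<^sup>2" using K0 by (simp add: power_mult_distrib mult.commute)
    qed (use K0 in simp)
  qed
  have "inner (A x) y = inner x (D y)" for x y
  proof -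
    have "((\<lambda>e. inner (A e) y * inner e x) has_sum inner (D y) x) onb"
      unfolding D_def by (rule inner_orthonormal_series[OF o sm])
    moreover have "((\<lambda>e. inner (A (inner x e *\<^sub>R e)) y) has_sum inner (A x) y) onb"
      by (rule has_sum_bounded_linear[OF _ has_sum_basis_expansion[OF B], of "\<lambda>x. inner (A x) y"])
         (intro bounded_linear_intros)
    ultimately show ?thesis
      by (simp add: blinfun.scaleR_right mult.commute inner_commute) (metis has_sum_unique inner_commute)
  qed
  thus ?thesis using that[of "Blinfun D"] by (simp add: bounded_linear_Blinfun_apply[OF bl])
qed

lemma blinfun_adjoint_eq:
  fixes A A' :: "'h::{real_inner,banach} \<Rightarrow>\<^sub>L 'h"
  assumes "\<And>x y. inner (A x) y = inner x (A' y)"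
  shows "blinfun_adjoint A = A'"
proof -
  have "adjoint (blinfun_apply A) = blinfun_apply A'" using assms by (intro adjoint_unique) auto
  thus ?thesis by (simp add: blinfun_adjoint_def blinfun_apply_inverse)
qed

text \<open>
  Hilbert-Schmidt operators have adjoints, so the change of basis applies. This permits computing the norm, and by
  polarization the inner product, in a basis adapted to the operator, such as an eigenbasis.
\<close>

lemma hs_norm_has_sum:
  fixes A :: "'a::{real_inner,banach} hs"
  assumes "orthonormal_basis B"
  shows "((\<lambda>e. (norm (Rep_hs A e))\<^sup>2) has_sum (norm A)\<^sup>2) B"
proof -
  have h: "hilbert_schmidt (Rep_hs A)" using Rep_hs[of A] by simp
  then obtain A' :: "'a \<Rightarrow>\<^sub>L 'a" where "\<And>x y. inner (Rep_hs A x) y = inner x (A' y)"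
    using hilbert_schmidt_adjoint_exists by blast
  moreover have "((\<lambda>e. (norm (Rep_hs A e))\<^sup>2) has_sum (norm A)\<^sup>2) onb"
    unfolding hs_norm_square using h by (intro has_sum_infsum) (simp add: hilbert_schmidt_def)
  ultimately show ?thesis using has_sum_norm_basis_change[OF orthonormal_basis_onb assms] by blast
qed

lemma hs_inner_has_sum:
  assumes B: "orthonormal_basis B"
  shows "((\<lambda>e. inner (Rep_hs A e) (Rep_hs A' e)) has_sum inner A A') B"
proof -
  have pol: "inner x y = 1/4 * ((norm (x + y))\<^sup>2 - (norm (x - y))\<^sup>2)" for x y :: "'z::real_inner"
    unfolding power2_norm_eq_inner inner_add_left inner_add_right inner_diff_left inner_diff_right
    by (simp add: inner_commute)
  have "((\<lambda>e. 1/4 * ((norm (Rep_hs (A + A') e))\<^sup>2 - (norm (Rep_hs (A - A') e))\<^sup>2)) has_sum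
      1/4 * ((norm (A + A'))\<^sup>2 - (norm (A - A'))\<^sup>2)) B"
    by (simp only: diff_conv_add_uminus)
       (intro has_sum_cmult_right has_sum_add has_sum_uminusI hs_norm_has_sum B)
  thus ?thesis
    unfolding pol[of A A'] pol[of "Rep_hs A _"]
    by (simp add: plus_hs.rep_eq minus_hs.rep_eq blinfun.add_left blinfun.diff_left)
qed

text \<open>
  A finite sum of compact segments; it contains the image of the unit ball under a truncated Hilbert-Schmidt operator.
\<close>

lemma compact_box_combinations:
  fixes v :: "'i \<Rightarrow> 'h::real_normed_vector"
  assumes "finite F"
  shows "compact {\<Sum>e\<in>F. c e *\<^sub>R v e | c. \<forall>e\<in>F. \<bar>c e\<bar> \<le> (1::real)}"
  using assms
proof induction
  case empty
  show ?case by simp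
next
  case (insert a F)
  have cs: "compact ((\<lambda>r. r *\<^sub>R v a) ` {-1..1})"
    by (intro compact_continuous_image continuous_intros compact_Icc)
  have "{\<Sum>e\<in>insert a F. c e *\<^sub>R v e | c. \<forall>e\<in>insert a F. \<bar>c e\<bar> \<le> (1::real)} =
     {x + y |x y. x \<in> (\<lambda>r. r *\<^sub>R v a) ` {-1..1} \<and> y \<in> {\<Sum>e\<in>F. c e *\<^sub>R v e | c. \<forall>e\<in>F. \<bar>c e\<bar> \<le> (1::real)}}"
    (is "?L = ?R")
  proof
    show "?L \<subseteq> ?R"
    proof
      fix z assume "z \<in> ?L"
      then obtain c where c: "\<forall>e\<in>insert a F. \<bar>c e\<bar> \<le> 1" and z: "z = (\<Sum>e\<in>insert a F. c e *\<^sub>R v e)" by blast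
      have "z = c a *\<^sub>R v a + (\<Sum>e\<in>F. c e *\<^sub>R v e)" using z insert by simp
      moreover have "c a *\<^sub>R v a \<in> (\<lambda>r. r *\<^sub>R v a) ` {-1..1}"
        using c by (intro imageI) (auto simp: abs_le_iff)
      ultimately show "z \<in> ?R" using c by blast
    qed
    show "?R \<subseteq> ?L"
    proof
      fix z assume "z \<in> ?R"
      then obtain r c where r: "r \<in> {-1..1}" and c: "\<forall>e\<in>F. \<bar>c e\<bar> \<le> 1"
        and z: "z = r *\<^sub>R v a + (\<Sum>e\<in>F. c e *\<^sub>R v e)" by blast
      define c' where "c' = c(a := r)"
      have "(\<Sum>e\<in>F. c e *\<^sub>R v e) = (\<Sum>e\<in>F. c' e *\<^sub>R v e)"
        using insert by (intro sum.cong) (auto simp: c'_def)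
      hence "z = (\<Sum>e\<in>insert a F. c' e *\<^sub>R v e)" using z insert by (simp add: c'_def)
      moreover have "\<forall>e\<in>insert a F. \<bar>c' e\<bar> \<le> 1" using c r by (auto simp: c'_def abs_le_iff)
      ultimately show "z \<in> ?L" by blast
    qed
  qed
  thus ?case using compact_sums[OF cs insert.IH] by simp
qed

text \<open>
  By Cauchy-Schwarz the part of \<open>A x\<close> that the truncation omits is bounded by the tail of the series of the
  \<open>(norm (A e))\<^sup>2\<close>, uniformly on the unit ball.
\<close>

lemma hilbert_schmidt_tail:
  fixes A :: "'h::{real_inner,banach} \<Rightarrow>\<^sub>L 'h"
  assumes A: "hilbert_schmidt A" and d: "0 < d"
  obtains F where "finite F" "F \<subseteq> onb"
    "\<And>x. norm x \<le> 1 \<Longrightarrow> norm (A x - (\<Sum>e\<in>F. inner x e *\<^sub>R A e)) \<le> d"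
proof -
  have B: "orthonormal_basis (onb :: 'h set)" by (rule orthonormal_basis_onb)
  hence o: "orthonormal (onb :: 'h set)" by (simp add: orthonormal_basis_def)
  define K where "K = (\<Sum>\<^sub>\<infinity>e\<in>onb. (norm (A e))\<^sup>2)"
  have sm: "(\<lambda>e. (norm (A e))\<^sup>2) summable_on onb" using A by (simp add: hilbert_schmidt_def)
  have "((\<lambda>e. (norm (A e))\<^sup>2) has_sum K) onb"
    unfolding K_def using sm by (rule has_sum_infsum)
  moreover have "0 < d\<^sup>2" using d by simp
  ultimately have "\<forall>\<^sub>F F in finite_subsets_at_top onb. dist (\<Sum>e\<in>F. (norm (A e))\<^sup>2) K < d\<^sup>2"
    unfolding has_sum_def by (rule tendstoD)
  then obtain F where F': "finite F \<and> F \<subseteq> onb \<and> (\<forall>G. finite G \<and> F \<subseteq> G \<and> G \<subseteq> onb \<longrightarrow>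
      dist (\<Sum>e\<in>G. (norm (A e))\<^sup>2) K < d\<^sup>2)"
    unfolding eventually_finite_subsets_at_top ..
  hence F: "finite F" "F \<subseteq> onb" and FK: "dist (\<Sum>e\<in>F. (norm (A e))\<^sup>2) K < d\<^sup>2" by auto
  have "norm (A x - (\<Sum>e\<in>F. inner x e *\<^sub>R A e)) \<le> d" if x: "norm x \<le> 1" for x
  proof -
    have "((\<lambda>e. A (inner x e *\<^sub>R e)) has_sum A x) onb"
      by (rule has_sum_bounded_linear[OF blinfun.bounded_linear_right has_sum_basis_expansion[OF B]])
    hence lim: "((\<lambda>G. norm ((\<Sum>e\<in>G. inner x e *\<^sub>R A e) - (\<Sum>e\<in>F. inner x e *\<^sub>R A e)))
        \<longlongrightarrow> norm (A x - (\<Sum>e\<in>F. inner x e *\<^sub>R A e))) (finite_subsets_at_top onb)"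
      unfolding has_sum_def by (intro tendsto_intros) (simp add: blinfun.scaleR_right)
    have bd: "norm ((\<Sum>e\<in>G. inner x e *\<^sub>R A e) - (\<Sum>e\<in>F. inner x e *\<^sub>R A e)) \<le> d"
      if G: "finite G" "F \<subseteq> G" "G \<subseteq> onb" for G
    proof -
      have "norm ((\<Sum>e\<in>G. inner x e *\<^sub>R A e) - (\<Sum>e\<in>F. inner x e *\<^sub>R A e)) = norm (\<Sum>e\<in>G-F. inner x e *\<^sub>R A e)"
        using G by (simp add: sum_diff)
      also have "\<dots> \<le> (\<Sum>e\<in>G-F. \<bar>inner x e\<bar> * \<bar>norm (A e)\<bar>)" by (rule sum_norm_le) simp
      also have "\<dots> \<le> L2_set (inner x) (G-F) * L2_set (\<lambda>e. norm (A e)) (G-F)" by (rule L2_set_mult_ineq)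
      also have "\<dots> \<le> 1 * d"
      proof (intro mult_mono L2_set_nonneg)
        have "(\<Sum>e\<in>G-F. (inner x e)\<^sup>2) \<le> (norm x)\<^sup>2" using G by (intro bessel[OF o]) auto
        also have "\<dots> \<le> 1" using x by (simp add: power_le_one)
        finally show "L2_set (inner x) (G-F) \<le> 1" by (simp add: L2_set_def)
        have "(\<Sum>e\<in>G-F. (norm (A e))\<^sup>2) = (\<Sum>e\<in>G. (norm (A e))\<^sup>2) - (\<Sum>e\<in>F. (norm (A e))\<^sup>2)"
          using G by (simp add: sum_diff)
        also have "\<dots> \<le> K - (\<Sum>e\<in>F. (norm (A e))\<^sup>2)"
          unfolding K_def using finite_sum_le_infsum[OF sm, of G] G by simp
        also have "\<dots> \<le> d\<^sup>2" using FK by (simp add: dist_real_def)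
        finally show "L2_set (\<lambda>e. norm (A e)) (G-F) \<le> d"
          unfolding L2_set_def using d by (intro real_le_lsqrt) auto
      qed simp_all
      finally show ?thesis by simp
    qed
    show ?thesis
    proof (rule tendsto_upperbound[OF lim])
      show "\<forall>\<^sub>F G in finite_subsets_at_top onb.
          norm ((\<Sum>e\<in>G. inner x e *\<^sub>R A e) - (\<Sum>e\<in>F. inner x e *\<^sub>R A e)) \<le> d"
        unfolding eventually_finite_subsets_at_top using F bd by auto
    qed simp
  qed
  thus ?thesis using that F by blast
qed

text \<open>
  Up to an arbitrarily small error the image of the unit ball lies in a compact set, hence it is totally bounded.
\<close>

lemma hilbert_schmidt_imp_compact:
  fixes A :: "'h::{real_inner,banach} \<Rightarrow>\<^sub>L 'h"
  assumes A: "hilbert_schmidt A"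
  shows "compact_operator A"
  unfolding compact_operator_def compact_eq_totally_bounded
proof (intro conjI allI impI)
  show "Topological_Spaces.complete (closure (blinfun_apply A ` cball 0 1))"
    by (simp add: complete_eq_closed)
  fix d :: real assume d: "0 < d"
  then obtain F where F: "finite F" "F \<subseteq> onb"
    and Fd: "\<And>x. norm x \<le> 1 \<Longrightarrow> norm (A x - (\<Sum>e\<in>F. inner x e *\<^sub>R A e)) \<le> d/3"
    using hilbert_schmidt_tail[OF A, of "d/3"] by (metis divide_pos_pos zero_less_numeral)
  define Q where "Q = {\<Sum>e\<in>F. c e *\<^sub>R A e | c. \<forall>e\<in>F. \<bar>c e\<bar> \<le> (1::real)}"
  have "compact Q" unfolding Q_def by (rule compact_box_combinations[OF F(1)])
  then obtain k where k: "finite k" "Q \<subseteq> (\<Union>x\<in>k. ball x (d/3))"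
    unfolding compact_eq_totally_bounded using d by (metis divide_pos_pos zero_less_numeral)
  have "blinfun_apply A ` cball 0 1 \<subseteq> (\<Union>x\<in>k. cball x (2*d/3))"
  proof
    fix z assume "z \<in> blinfun_apply A ` cball 0 1"
    then obtain x where x: "norm x \<le> 1" and z: "z = A x" by auto
    define q where "q = (\<Sum>e\<in>F. inner x e *\<^sub>R A e)"
    have "\<bar>inner x e\<bar> \<le> 1" if "e \<in> F" for e
    proof -
      have "norm e = 1"
        using that F orthonormal_basis_onb by (auto simp: orthonormal_basis_def orthonormal_def)
      thus ?thesis using Cauchy_Schwarz_ineq2[of x e] x by simp
    qed
    hence "q \<in> Q" unfolding Q_def q_def by blast
    then obtain y where y: "y \<in> k" "dist y q < d/3" using k by auto
    have "dist q z \<le> d/3" using Fd[OF x] by (simp add: z q_def dist_norm norm_minus_commute)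
    hence "dist y z \<le> 2*d/3" using y dist_triangle[of y z q] by simp
    thus "z \<in> (\<Union>x\<in>k. cball x (2*d/3))" using y by auto
  qed
  moreover have "closed (\<Union>x\<in>k. cball x (2*d/3))" using k by (intro closed_UN) auto
  ultimately have "closure (blinfun_apply A ` cball 0 1) \<subseteq> (\<Union>x\<in>k. cball x (2*d/3))"
    by (rule closure_minimal)
  also have "\<dots> \<subseteq> (\<Union>x\<in>k. ball x d)" using d by (intro UN_mono) auto
  finally show "\<exists>k. finite k \<and> closure (blinfun_apply A ` cball 0 1) \<subseteq> (\<Union>x\<in>k. ball x d)"
    using k by blast
qed

section \<open>The spectral theorem for compact symmetric operators\<close>

text \<open>
  Let \<open>m\<close> be the norm of the restriction of \<open>T\<close> to \<open>K\<close>. Along a maximizing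
  sequence \<open>x n\<close> of unit vectors the vectors \<open>T (T (x n)) - m\<^sup>2 *\<^sub>R x n\<close> tend to
  zero; compactness then produces a nonzero limit \<open>y\<close> of the \<open>T (x n)\<close> with
  \<open>T (T y) = m\<^sup>2 *\<^sub>R y\<close>. Since \<open>T\<^sup>2 - m\<^sup>2 = (T + m) (T - m)\<close>, either
  \<open>y\<close> is an eigenvector for \<open>m\<close> or \<open>T y - m *\<^sub>R y\<close> is one for
  \<open>- m\<close>.
\<close>

lemma symmetric_compact_eigenvector:
  fixes T :: "'h::{real_inner,banach} \<Rightarrow>\<^sub>L 'h"
  assumes cpt: "compact_operator T"
    and sym: "\<And>x y. inner (T x) y = inner x (T y)"
    and K: "subspace K" "closed K" "\<And>x. x \<in> K \<Longrightarrow> T x \<in> K"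
    and nz: "z \<in> K" "z \<noteq> 0"
  obtains u s where "u \<in> K" "norm u = 1" "T u = s *\<^sub>R u"
proof -
  have normalize: thesis if w: "w \<in> K" "w \<noteq> 0" and ev: "T w = s *\<^sub>R w" for w s
  proof (rule \<open>\<And>u s. u \<in> K \<Longrightarrow> norm u = 1 \<Longrightarrow> T u = s *\<^sub>R u \<Longrightarrow> thesis\<close>)
    show "sgn w \<in> K" using w K(1) by (simp add: sgn_div_norm subspace_scale)
    show "norm (sgn w) = 1" using w by (simp add: norm_sgn)
    show "T (sgn w) = s *\<^sub>R sgn w" by (simp add: sgn_div_norm blinfun.scaleR_right ev)
  qed
  define m where "m = (SUP x\<in>{x\<in>K. norm x = 1}. norm (T x))"
  have ne: "{x\<in>K. norm x = 1} \<noteq> {}"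
    using nz K(1) by (auto intro!: exI[of _ "sgn z"] simp: norm_sgn sgn_div_norm subspace_scale)
  have bdd: "bdd_above ((\<lambda>x. norm (T x)) ` {x\<in>K. norm x = 1})"
    using norm_blinfun[of T] by (intro bdd_aboveI2[where M="norm T"]) (auto, metis mult.right_neutral)
  have m1: "norm (T x) \<le> m" if "x \<in> K" "norm x = 1" for x
    unfolding m_def using that by (intro cSUP_upper bdd) auto
  have m2: "norm (T x) \<le> m * norm x" if "x \<in> K" for x
  proof (cases "x = 0")
    case False
    hence "norm (T (sgn x)) \<le> m" using that K(1)
      by (intro m1) (auto simp: norm_sgn sgn_div_norm subspace_scale)
    thus ?thesis using False by (simp add: sgn_div_norm blinfun.scaleR_right field_simps)
  qed simp
  have m0: "0 \<le> m" using ne m1 norm_ge_zero order_trans by (metis (mono_tags, lifting) empty_Collect_eq)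
  show thesis
  proof (cases "m = 0")
    case True
    hence "T z = 0 *\<^sub>R z" using m2[OF nz(1)] by simp
    thus thesis using normalize nz by blast
  next
    case False
    hence mp: "0 < m" using m0 by simp
    have "\<exists>x\<in>K. norm x = 1 \<and> m - inverse (real (Suc n)) < norm (T x)" for n
    proof -
      have "m - inverse (real (Suc n)) < m" by simp
      hence "\<exists>x\<in>{x\<in>K. norm x = 1}. m - inverse (real (Suc n)) < norm (T x)"
        unfolding m_def by (subst (asm) less_cSUP_iff[OF ne bdd]) auto
      thus ?thesis by blast
    qed
    then obtain x where xK: "\<And>n. x n \<in> K" and x1: "\<And>n. norm (x n) = 1"
      and xm: "\<And>n. m - inverse (real (Suc n)) < norm (T (x n))" by metis
    have lim_m: "(\<lambda>n. norm (T (x n))) \<longlonglongrightarrow> m"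
    proof (rule tendsto_sandwich)
      show "(\<lambda>n. m - inverse (real (Suc n))) \<longlonglongrightarrow> m"
        using tendsto_diff[OF tendsto_const[of m] LIMSEQ_inverse_real_of_nat] by simp
      show "\<forall>\<^sub>F n in sequentially. m - inverse (real (Suc n)) \<le> norm (T (x n))"
        by (rule always_eventually, rule allI, rule less_imp_le, rule xm)
      show "\<forall>\<^sub>F n in sequentially. norm (T (x n)) \<le> m"
        by (rule always_eventually, rule allI, rule m1[OF xK x1])
    qed simp
    have "seq_compact (closure (blinfun_apply T ` cball 0 1))"
      using cpt by (simp add: compact_operator_def compact_eq_seq_compact_metric)
    moreover have "T (x n) \<in> closure (blinfun_apply T ` cball 0 1)" for n
      using x1 by (intro subsetD[OF closure_subset]) (auto intro!: imageI)
    ultimately obtain y r where r: "strict_mono r" and y': "((\<lambda>n. T (x n)) \<circ> r) \<longlonglongrightarrow> y"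
      using seq_compactE[of "closure (blinfun_apply T ` cball 0 1)" "\<lambda>n. T (x n)"] by blast
    have y: "(\<lambda>n. T (x (r n))) \<longlonglongrightarrow> y" using y' by (simp add: comp_def)
    have "norm y = m"
      using tendsto_norm[OF y] LIMSEQ_subseq_LIMSEQ[OF lim_m r, unfolded comp_def]
      by (rule LIMSEQ_unique)
    hence y0: "y \<noteq> 0" using mp by auto
    have yK: "y \<in> K"
      by (rule closed_sequentially[OF K(2) _ y]) (use K(3) xK in auto)
    \<comment> \<open>Expand the square; \<open>T x\<close> lies in \<open>K\<close>, so \<open>norm (T (T x)) \<le> m * norm (T x)\<close>.\<close>
    have gap: "(norm (T (T (x n)) - m\<^sup>2 *\<^sub>R x n))\<^sup>2 \<le> m\<^sup>2 * (m\<^sup>2 - (norm (T (x n)))\<^sup>2)" for n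
    proof -
      have "(norm (T (T (x n)) - m\<^sup>2 *\<^sub>R x n))\<^sup>2
          = (norm (T (T (x n))))\<^sup>2 - 2 * m\<^sup>2 * inner (T (T (x n))) (x n) + m\<^sup>2 * m\<^sup>2 * (norm (x n))\<^sup>2"
        unfolding power2_norm_eq_inner[of "T (T (x n)) - m\<^sup>2 *\<^sub>R x n"] inner_diff_left inner_diff_right
        by (simp add: inner_commute power2_norm_eq_inner)
      also have "inner (T (T (x n))) (x n) = (norm (T (x n)))\<^sup>2"
        by (simp add: sym power2_norm_eq_inner)
      also have "(norm (T (T (x n))))\<^sup>2 \<le> (m * norm (T (x n)))\<^sup>2"
        using m2[OF K(3)[OF xK]] by (intro power_mono) auto
      finally show ?thesis by (simp add: x1 power_mult_distrib algebra_simps)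
    qed
    have "(\<lambda>n. T (T (x (r n))) - m\<^sup>2 *\<^sub>R x (r n)) \<longlonglongrightarrow> 0"
    proof -
      have "(\<lambda>n. m\<^sup>2 * (m\<^sup>2 - (norm (T (x n)))\<^sup>2)) \<longlonglongrightarrow> m\<^sup>2 * (m\<^sup>2 - m\<^sup>2)"
        by (intro tendsto_intros lim_m)
      hence "(\<lambda>n. m\<^sup>2 * (m\<^sup>2 - (norm (T (x n)))\<^sup>2)) \<longlonglongrightarrow> 0" by simp
      hence "(\<lambda>n. (norm (T (T (x n)) - m\<^sup>2 *\<^sub>R x n))\<^sup>2) \<longlonglongrightarrow> 0"
        by (rule tendsto_sandwich[OF _ _ tendsto_const, rotated 2])
           (rule always_eventually, rule allI, rule zero_le_power2 gap)+
      hence "(\<lambda>n. sqrt ((norm (T (T (x n)) - m\<^sup>2 *\<^sub>R x n))\<^sup>2)) \<longlonglongrightarrow> sqrt 0" by (intro tendsto_intros)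
      hence "(\<lambda>n. T (T (x n)) - m\<^sup>2 *\<^sub>R x n) \<longlonglongrightarrow> 0" by (simp add: tendsto_norm_zero_iff)
      from LIMSEQ_subseq_LIMSEQ[OF this r] show ?thesis by (simp add: comp_def)
    qed
    moreover have TTy: "(\<lambda>n. T (T (x (r n)))) \<longlonglongrightarrow> T y" by (intro tendsto_intros y)
    ultimately have "(\<lambda>n. T (T (x (r n))) - (T (T (x (r n))) - m\<^sup>2 *\<^sub>R x (r n))) \<longlonglongrightarrow> T y - 0"
      by (intro tendsto_diff)
    hence "(\<lambda>n. m\<^sup>2 *\<^sub>R x (r n)) \<longlonglongrightarrow> T y" by simp
    hence "(\<lambda>n. T (m\<^sup>2 *\<^sub>R x (r n))) \<longlonglongrightarrow> T (T y)" by (intro tendsto_intros)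
    moreover have "(\<lambda>n. T (m\<^sup>2 *\<^sub>R x (r n))) \<longlonglongrightarrow> m\<^sup>2 *\<^sub>R y"
      unfolding blinfun.scaleR_right by (intro tendsto_intros y)
    ultimately have TT: "T (T y) = m\<^sup>2 *\<^sub>R y" by (rule LIMSEQ_unique)
    define w where "w = T y - m *\<^sub>R y"
    show thesis
    proof (cases "w = 0")
      case True
      thus thesis using normalize[OF yK y0, of m] by (simp add: w_def)
    next
      case False
      have "w \<in> K" unfolding w_def using K(1,3) yK by (intro subspace_diff subspace_scale) auto
      moreover have "T w = (- m) *\<^sub>R w"
        by (simp add: w_def blinfun.diff_right blinfun.scaleR_right TT power2_eq_square scaleR_diff_right)
      ultimately show thesis using normalize False by blast
    qed
  qed
qed

text \<open>
  A maximal orthonormal set of eigenvectors exists by Zorn's lemma. Its orthogonal complement is invariant, so if it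
  were nonzero it would contain a further eigenvector.
\<close>

theorem compact_spectral_theorem:
  fixes T :: "'h::{real_inner,banach} \<Rightarrow>\<^sub>L 'h"
  assumes cpt: "compact_operator T"
    and sym: "\<And>x y. inner (T x) y = inner x (T y)"
  obtains B s where "orthonormal_basis B" "\<And>e. e \<in> B \<Longrightarrow> T e = s e *\<^sub>R e"
proof -
  define P where "P = {B. orthonormal B \<and> (\<forall>e\<in>B. \<exists>s. T e = s *\<^sub>R e)}"
  have "\<exists>B\<in>P. \<forall>X\<in>P. B \<subseteq> X \<longrightarrow> X = B"
  proof (rule subset_Zorn)
    fix \<C> assume c: "subset.chain P \<C>"
    have "orthonormal (\<Union>\<C>)"
      unfolding orthonormal_def
    proof (intro conjI)
      show "pairwise orthogonal (\<Union>\<C>)"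
      proof (rule pairwiseI)
        fix x y assume "x \<in> \<Union>\<C>" "y \<in> \<Union>\<C>" and ne: "x \<noteq> y"
        then obtain A B where AB: "A \<in> \<C>" "x \<in> A" "B \<in> \<C>" "y \<in> B" by blast
        hence "A \<subseteq> B \<or> B \<subseteq> A" using c unfolding subset_chain_def by blast
        moreover have "orthonormal A" "orthonormal B" using c AB unfolding subset_chain_def P_def by auto
        ultimately show "orthogonal x y"
          using AB ne unfolding orthonormal_def pairwise_def by blast
      qed
      show "\<forall>e\<in>\<Union>\<C>. norm e = 1"
        using c unfolding subset_chain_def orthonormal_def P_def by blast
    qed
    hence "\<Union>\<C> \<in> P" using c unfolding P_def subset_chain_def by blast
    thus "\<exists>U\<in>P. \<forall>X\<in>\<C>. X \<subseteq> U" by blast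
  qed
  then obtain B where BP: "B \<in> P" and mx: "\<And>X. X \<in> P \<Longrightarrow> B \<subseteq> X \<Longrightarrow> X = B" by auto
  have o: "orthonormal B" and "\<forall>e\<in>B. \<exists>s. T e = s *\<^sub>R e" using BP by (auto simp: P_def)
  then obtain s where s: "\<And>e. e \<in> B \<Longrightarrow> T e = s e *\<^sub>R e" by metis
  have "x \<in> closure (span B)" for x
  proof (rule ccontr)
    assume x: "x \<notin> closure (span B)"
    obtain p where p: "p \<in> closure (span B)" "\<forall>e\<in>B. norm e = 1 \<longrightarrow> inner (x - p) e = 0"
      using orthogonal_projection_exists by blast
    define K where "K = {z. \<forall>e\<in>B. inner z e = 0}"
    have "x - p \<in> K" "x - p \<noteq> 0" using p x o by (auto simp: K_def orthonormal_def)
    moreover have "subspace K" by (auto simp: K_def subspace_def inner_add_left)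
    moreover have "closed K"
    proof -
      have "K = (\<Inter>e\<in>B. {z. inner z e = 0})" by (auto simp: K_def)
      thus ?thesis by (auto intro!: closed_INT closed_Collect_eq continuous_intros)
    qed
    moreover have "T z \<in> K" if "z \<in> K" for z
      using that by (simp add: K_def sym s)
    ultimately obtain u c where u: "u \<in> K" "norm u = 1" "T u = c *\<^sub>R u"
      using symmetric_compact_eigenvector[OF cpt sym] by metis
    have "orthonormal (insert u B)"
      using o u by (auto simp: orthonormal_def pairwise_insert orthogonal_def inner_commute K_def)
    hence "insert u B \<in> P" using BP u(3) by (auto simp: P_def)
    hence "u \<in> B" using mx[of "insert u B"] by blast
    hence "inner u u = 0" using u(1) by (auto simp: K_def)
    thus False using u(2) by simp
  qed
  hence "orthonormal_basis B" using o by (auto simp: orthonormal_basis_def)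
  thus ?thesis using s by (rule that)
qed

section \<open>Square roots\<close>

text \<open>
  This is what makes nonnegative square roots unique: \<open>(R + \<surd>s) (R - \<surd>s) e = 0\<close>, and
  \<open>R + \<surd>s\<close> is injective for \<open>s > 0\<close>.
\<close>

lemma sqrt_eigenvector:
  fixes R :: "'h::{real_inner,banach} \<Rightarrow>\<^sub>L 'h"
  assumes R: "nonneg_definite R" and e: "R (R e) = s *\<^sub>R e" and s: "0 \<le> s"
  shows "R e = sqrt s *\<^sub>R e"
proof (cases "s = 0")
  case True
  have "inner (R e) (R e) = 0" using R e True by (simp add: nonneg_definite_def)
  thus ?thesis using True by simp
next
  case False
  define y where "y = R e - sqrt s *\<^sub>R e"
  have "R y = - (sqrt s *\<^sub>R y)"
    using s by (simp add: y_def blinfun.diff_right blinfun.scaleR_right e scaleR_diff_right flip: real_sqrt_mult)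
  hence "sqrt s * inner y y \<le> 0" using R unfolding nonneg_definite_def
    by (metis inner_minus_left inner_scaleR_left neg_0_le_iff_le)
  moreover have "0 < sqrt s" using s False by simp
  ultimately have "inner y y \<le> 0" by (simp add: mult_le_0_iff)
  hence "y = 0" by (metis inner_eq_zero_iff inner_ge_zero order_antisym)
  thus ?thesis by (simp add: y_def)
qed

text \<open>
  The operator with eigenvalues \<open>\<surd>(s e)\<close> is a square root, and any other has the same values on the
  basis. The hypothesis is diagonalizability rather than compactness, so that the lemma can be iterated; the trace norm
  is defined by a fourth root.
\<close>

lemma op_sqrt_diagonal:
  fixes T :: "'h::{real_inner,banach} \<Rightarrow>\<^sub>L 'h"
  assumes B: "orthonormal_basis B" and T: "\<And>e. e \<in> B \<Longrightarrow> T e = s e *\<^sub>R e"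
    and s: "\<And>e. e \<in> B \<Longrightarrow> 0 \<le> s e"
  shows "nonneg_definite (op_sqrt T)" "op_sqrt T o\<^sub>L op_sqrt T = T"
    and "\<And>e. e \<in> B \<Longrightarrow> op_sqrt T e = sqrt (s e) *\<^sub>R e"
proof -
  have "sqrt (s e) \<le> sqrt (norm T)" if "e \<in> B" for e
  proof -
    have "norm e = 1" using that B by (auto simp: orthonormal_basis_def orthonormal_def)
    thus ?thesis using norm_blinfun[of T e] T[OF that] by simp
  qed
  then obtain D where D: "nonneg_definite D" "\<And>e. e \<in> B \<Longrightarrow> D e = sqrt (s e) *\<^sub>R e"
    using diagonal_operator_exists[OF B, of "\<lambda>e. sqrt (s e)" "sqrt (norm T)"] s by auto
  have DD: "D o\<^sub>L D = T"
    by (rule blinfun_eq_on_basis[OF B])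
       (use s in \<open>auto simp: D(2) blinfun.scaleR_right T simp flip: real_sqrt_mult\<close>)
  have un: "R = D" if R: "nonneg_definite R \<and> R o\<^sub>L R = T" for R
  proof (rule blinfun_eq_on_basis[OF B])
    fix e assume e: "e \<in> B"
    have "R (R e) = s e *\<^sub>R e" using R T[OF e] by (metis blinfun_apply_blinfun_compose)
    thus "R e = D e" using sqrt_eigenvector[of R e "s e"] R s[OF e] D(2)[OF e] by simp
  qed
  have eq: "op_sqrt T = D" unfolding op_sqrt_def
  proof (rule the_equality)
    show "nonneg_definite D \<and> D o\<^sub>L D = T" using D(1) DD by (rule conjI)
  qed (rule un)
  show "nonneg_definite (op_sqrt T)" unfolding eq by (rule D(1))
  show "op_sqrt T o\<^sub>L op_sqrt T = T" unfolding eq by (rule DD)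
  show "op_sqrt T e = sqrt (s e) *\<^sub>R e" if "e \<in> B" for e unfolding eq using that by (rule D(2))
qed

lemma nonneg_compact_eigenbasis:
  fixes T :: "'h::{real_inner,banach} \<Rightarrow>\<^sub>L 'h"
  assumes "compact_operator T" "nonneg_definite T"
  obtains B s where "orthonormal_basis B" "\<And>e. e \<in> B \<Longrightarrow> T e = s e *\<^sub>R e" "\<And>e. e \<in> B \<Longrightarrow> 0 \<le> s e"
proof -
  have sym: "inner (T x) y = inner x (T y)" for x y using assms(2) by (simp add: nonneg_definite_def)
  show thesis
  proof (rule compact_spectral_theorem[OF assms(1) sym])
    fix B s assume B: "orthonormal_basis B" "\<And>e. e \<in> B \<Longrightarrow> T e = s e *\<^sub>R e"
    have "0 \<le> s e" if e: "e \<in> B" for e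
    proof -
      have "norm e = 1" using e B(1) by (auto simp: orthonormal_basis_def orthonormal_def)
      hence se: "inner (T e) e = s e" using B(2)[OF e] by (simp add: dot_square_norm)
      have "0 \<le> inner (T e) e" using assms(2) unfolding nonneg_definite_def by blast
      thus ?thesis unfolding se .
    qed
    with B show thesis by (rule that)
  qed
qed

section \<open>The trace norm as a dual norm\<close>

lemma finite_sum_le_hs_norm_square:
  fixes A :: "'h::{real_inner,banach} \<Rightarrow>\<^sub>L 'h"
  assumes B: "orthonormal_basis B" and F: "finite F" "F \<subseteq> B"
  shows "ennreal (\<Sum>e\<in>F. (norm (A e))\<^sup>2) \<le> (hs_norm A)\<^sup>2"
proof (cases "hilbert_schmidt A")
  case True
  hence "((\<lambda>e. (norm (A e))\<^sup>2) has_sum (norm (Abs_hs A))\<^sup>2) B"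
    using hs_norm_has_sum[OF B, of "Abs_hs A"] by (simp add: Abs_hs_inverse)
  hence "(\<Sum>e\<in>F. (norm (A e))\<^sup>2) \<le> (norm (Abs_hs A))\<^sup>2"
    using F by (rule finite_sum_le_has_sum) auto
  thus ?thesis using True by (simp add: hs_norm_def ennreal_power)
qed (simp add: hs_norm_def)

text \<open>
  Symmetry serves to move the sum to the basis of the definition: \<open>has_sum_norm_basis_change\<close> requires an
  adjoint, and here the operator is its own.
\<close>

lemma symmetric_hs_norm_square_le:
  fixes A :: "'h::{real_inner,banach} \<Rightarrow>\<^sub>L 'h"
  assumes B: "orthonormal_basis B" and sym: "\<And>x y. inner (A x) y = inner x (A y)"
    and le: "\<And>F. finite F \<Longrightarrow> F \<subseteq> B \<Longrightarrow> (\<Sum>e\<in>F. (norm (A e))\<^sup>2) \<le> K"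
  shows "(hs_norm A)\<^sup>2 \<le> ennreal K"
proof -
  have "(\<lambda>e. (norm (A e))\<^sup>2) summable_on B"
    by (rule nonneg_bdd_above_summable_on) (auto intro!: bdd_aboveI2[where M=K] le)
  then obtain S where S: "((\<lambda>e. (norm (A e))\<^sup>2) has_sum S) B" by (auto simp: summable_on_def)
  have "S \<le> K" using S le by (rule has_sum_le_finite_sums)
  have "((\<lambda>e. (norm (A e))\<^sup>2) has_sum S) onb"
    by (rule has_sum_norm_basis_change[OF B orthonormal_basis_onb sym S])
  hence h: "hilbert_schmidt A" by (auto simp: hilbert_schmidt_def summable_on_def)
  hence "((\<lambda>e. (norm (A e))\<^sup>2) has_sum (norm (Abs_hs A))\<^sup>2) B"
    using hs_norm_has_sum[OF B, of "Abs_hs A"] by (simp add: Abs_hs_inverse)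
  hence "(norm (Abs_hs A))\<^sup>2 = S" using S has_sum_unique by blast
  thus ?thesis using h \<open>S \<le> K\<close> by (simp add: hs_norm_def ennreal_power ennreal_leI)
qed

text \<open>
  These operators, which map \<open>e\<close> to \<open>g e\<close> for \<open>e \<in> F\<close> and annihilate the rest
  of the basis, are the test operators against which the trace norm is bounded from below.
\<close>

lemma finite_rank_contraction:
  fixes B :: "'h::{real_inner,banach} set"
  assumes B: "orthonormal_basis B" and F: "finite F" "F \<subseteq> B"
    and orth: "\<And>e f. e \<in> F \<Longrightarrow> f \<in> F \<Longrightarrow> e \<noteq> f \<Longrightarrow> inner (g e) (g f) = 0"
    and g1: "\<And>e. e \<in> F \<Longrightarrow> norm (g e) \<le> 1"
  obtains K :: "'h hs" where "norm (Rep_hs K) \<le> 1"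
    "\<And>A. inner A K = (\<Sum>e\<in>F. inner (Rep_hs A e) (g e))"
proof -
  have o: "orthonormal B" using B by (simp add: orthonormal_basis_def)
  define k where "k x = (\<Sum>e\<in>F. inner x e *\<^sub>R g e)" for x
  define k' where "k' y = (\<Sum>e\<in>F. inner y (g e) *\<^sub>R e)" for y
  have bk: "bounded_linear k" unfolding k_def
    by (intro bounded_linear_sum bounded_linear_scaleR_const bounded_linear_inner_left)
  have bk': "bounded_linear k'" unfolding k'_def
    by (intro bounded_linear_sum bounded_linear_scaleR_const bounded_linear_inner_left)
  define L where "L = Blinfun k"
  have L: "blinfun_apply L = k" unfolding L_def by (rule bounded_linear_Blinfun_apply[OF bk])
  have L': "blinfun_apply (Blinfun k') = k'" by (rule bounded_linear_Blinfun_apply[OF bk'])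
  have adj: "inner (L x) y = inner x (Blinfun k' y)" for x y
    unfolding L L' k_def k'_def by (simp add: inner_sum_left inner_sum_right inner_commute mult.commute)
  have Le: "L e = (if e \<in> F then g e else 0)" if "e \<in> B" for e
  proof -
    have "L e = (\<Sum>f\<in>F. if f = e then g f else 0)" unfolding L k_def
      using that F(2) by (intro sum.cong) (auto simp: orthonormal_inner[OF o])
    also have "\<dots> = (if e \<in> F then g e else 0)" using F(1) by simp
    finally show ?thesis .
  qed
  have "((\<lambda>e. (norm (L e))\<^sup>2) has_sum (\<Sum>e\<in>F. (norm (g e))\<^sup>2)) B"
    using F by (subst has_sum_cong_neutral[where T=F and g="\<lambda>e. (norm (g e))\<^sup>2"])
      (auto simp: Le intro: has_sum_finite)
  hence "((\<lambda>e. (norm (L e))\<^sup>2) has_sum (\<Sum>e\<in>F. (norm (g e))\<^sup>2)) onb"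
    by (rule has_sum_norm_basis_change[OF B orthonormal_basis_onb adj])
  hence h: "hilbert_schmidt L" by (auto simp: hilbert_schmidt_def summable_on_def)
  have rep: "Rep_hs (Abs_hs L) = L" using h by (simp add: Abs_hs_inverse)
  have "norm L \<le> 1"
  proof (rule norm_blinfun_bound)
    fix x
    have "(norm (L x))\<^sup>2 = (\<Sum>e\<in>F. (inner x e)\<^sup>2 * (norm (g e))\<^sup>2)"
      unfolding L k_def by (rule norm_orthogonal_sum[OF F(1) orth])
    also have "\<dots> \<le> (\<Sum>e\<in>F. (inner x e)\<^sup>2)"
      using g1 by (intro sum_mono mult_right_le_one_le) (auto simp: power_le_one)
    also have "\<dots> \<le> (norm x)\<^sup>2" by (rule bessel[OF o F])
    finally have "norm (L x) \<le> norm x" by (rule power2_le_imp_le) simp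
    thus "norm (L x) \<le> 1 * norm x" by simp
  qed simp
  moreover have "inner A (Abs_hs L) = (\<Sum>e\<in>F. inner (Rep_hs A e) (g e))" for A
  proof -
    have "((\<lambda>e. inner (Rep_hs A e) (L e)) has_sum (\<Sum>e\<in>F. inner (Rep_hs A e) (g e))) B"
      using F by (subst has_sum_cong_neutral[where T=F and g="\<lambda>e. inner (Rep_hs A e) (g e)"])
        (auto simp: Le intro: has_sum_finite)
    moreover have "((\<lambda>e. inner (Rep_hs A e) (L e)) has_sum inner A (Abs_hs L)) B"
      using hs_inner_has_sum[OF B, of A "Abs_hs L"] by (simp only: rep)
    ultimately show ?thesis by (rule has_sum_unique[symmetric])
  qed
  ultimately show ?thesis using that[of "Abs_hs L"] rep by simp
qed

text \<open>
  Diagonalize \<open>A\<^sup>* A\<close>. Its eigenvalues are the squares of the singular values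
  \<open>s e = norm (A e)\<close>, so its fourth root, whose Hilbert-Schmidt norm defines the trace norm, has the
  eigenvalues \<open>\<surd>(s e)\<close>.
\<close>

lemma singular_value_decomposition:
  fixes A :: "'h::{real_inner,banach} hs"
  obtains B s where "orthonormal_basis B" "\<And>e. e \<in> B \<Longrightarrow> norm (Rep_hs A e) = s e"
    "\<And>e f. e \<in> B \<Longrightarrow> f \<in> B \<Longrightarrow> e \<noteq> f \<Longrightarrow> inner (Rep_hs A e) (Rep_hs A f) = 0"
    "nonneg_definite (op_sqrt (op_sqrt (blinfun_adjoint (Rep_hs A) o\<^sub>L Rep_hs A)))"
    "\<And>e. e \<in> B \<Longrightarrow> op_sqrt (op_sqrt (blinfun_adjoint (Rep_hs A) o\<^sub>L Rep_hs A)) e = sqrt (s e) *\<^sub>R e"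
proof -
  have h: "hilbert_schmidt (Rep_hs A)" using Rep_hs[of A] by simp
  obtain A' :: "'h \<Rightarrow>\<^sub>L 'h" where A': "\<And>x y. inner (Rep_hs A x) y = inner x (A' y)"
    using hilbert_schmidt_adjoint_exists[OF h] by blast
  have ad: "blinfun_adjoint (Rep_hs A) = A'" by (rule blinfun_adjoint_eq[OF A'])
  define T where "T = A' o\<^sub>L Rep_hs A"
  have Tin: "inner (T x) y = inner (Rep_hs A x) (Rep_hs A y)" for x y
    using A'[of y "Rep_hs A x"] by (simp add: T_def inner_commute)
  have nn: "nonneg_definite T"
    unfolding nonneg_definite_def by (simp add: Tin) (metis Tin inner_commute)
  have "hilbert_schmidt T"
    unfolding hilbert_schmidt_def
  proof (rule summable_on_comparison_test)
    show "(\<lambda>e. (norm A')\<^sup>2 * (norm (Rep_hs A e))\<^sup>2) summable_on onb"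
      using h by (intro summable_on_cmult_right) (simp add: hilbert_schmidt_def)
    show "(norm (T e))\<^sup>2 \<le> (norm A')\<^sup>2 * (norm (Rep_hs A e))\<^sup>2" for e
      unfolding power_mult_distrib[symmetric] by (intro power_mono) (simp_all add: T_def norm_blinfun)
  qed simp
  hence "compact_operator T" by (rule hilbert_schmidt_imp_compact)
  from this nn obtain B t where B: "orthonormal_basis B" and t: "\<And>e. e \<in> B \<Longrightarrow> T e = t e *\<^sub>R e"
    and t0: "\<And>e. e \<in> B \<Longrightarrow> 0 \<le> t e"
    by (rule nonneg_compact_eigenbasis) (rule that)
  have o: "orthonormal B" using B by (simp add: orthonormal_basis_def)
  have inA: "inner (Rep_hs A e) (Rep_hs A f) = (if e = f then t e else 0)" if "e \<in> B" "f \<in> B" for e f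
    using Tin[of e f] t[OF that(1)] orthonormal_inner[OF o that] by (cases "e = f") auto
  have q1: "op_sqrt T e = sqrt (t e) *\<^sub>R e" if "e \<in> B" for e
    by (rule op_sqrt_diagonal(3)[OF B t t0 that])
  have q0: "0 \<le> sqrt (t e)" if "e \<in> B" for e using t0[OF that] by simp
  show ?thesis
  proof (rule that[OF B])
    show "norm (Rep_hs A e) = sqrt (t e)" if "e \<in> B" for e
      using inA[OF that that] by (simp add: norm_eq_sqrt_inner)
    show "inner (Rep_hs A e) (Rep_hs A f) = 0" if "e \<in> B" "f \<in> B" "e \<noteq> f" for e f
      using inA[OF that(1,2)] that by simp
    show "nonneg_definite (op_sqrt (op_sqrt (blinfun_adjoint (Rep_hs A) o\<^sub>L Rep_hs A)))"
      unfolding ad T_def[symmetric] by (rule op_sqrt_diagonal(1)[OF B q1 q0])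
    show "op_sqrt (op_sqrt (blinfun_adjoint (Rep_hs A) o\<^sub>L Rep_hs A)) e = sqrt (sqrt (t e)) *\<^sub>R e"
      if "e \<in> B" for e
      unfolding ad T_def[symmetric] by (rule op_sqrt_diagonal(3)[OF B q1 q0 that])
  qed
qed

text \<open>
  In the basis of singular vectors \<open>inner A K\<close> is the sum of the
  \<open>inner (A e) (K e) \<le> norm (A e) = s e\<close>, and the trace norm is the sum of the \<open>s e\<close>.
\<close>

lemma inner_le_trace_norm:
  fixes A K :: "'h::{real_inner,banach} hs"
  assumes K: "norm (Rep_hs K) \<le> 1"
  shows "ennreal (inner A K) \<le> trace_norm (Rep_hs A)"
proof (rule singular_value_decomposition[of A])
  fix B s
  assume B: "orthonormal_basis B" and s: "\<And>e. e \<in> B \<Longrightarrow> norm (Rep_hs A e) = s e"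
    and S: "\<And>e. e \<in> B \<Longrightarrow> op_sqrt (op_sqrt (blinfun_adjoint (Rep_hs A) o\<^sub>L Rep_hs A)) e = sqrt (s e) *\<^sub>R e"
  have n1: "norm e = 1" if "e \<in> B" for e
    using that B by (auto simp: orthonormal_basis_def orthonormal_def)
  have s0: "0 \<le> s e" if "e \<in> B" for e using s[OF that] norm_ge_zero by metis
  have fin: "ennreal (\<Sum>e\<in>F. s e) \<le> trace_norm (Rep_hs A)" if F: "finite F" "F \<subseteq> B" for F
  proof -
    have "(\<Sum>e\<in>F. s e) = (\<Sum>e\<in>F. (norm (op_sqrt (op_sqrt (blinfun_adjoint (Rep_hs A) o\<^sub>L Rep_hs A)) e))\<^sup>2)"
      using F by (intro sum.cong) (auto simp: S n1 s0 subset_iff)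
    thus ?thesis unfolding trace_norm_def using finite_sum_le_hs_norm_square[OF B F] by simp
  qed
  show ?thesis
  proof (cases "trace_norm (Rep_hs A)")
    case (real t)
    have "(\<Sum>e\<in>F. inner (Rep_hs A e) (Rep_hs K e)) \<le> t" if F: "finite F" "F \<subseteq> B" for F
    proof -
      have "inner (Rep_hs A e) (Rep_hs K e) \<le> s e" if "e \<in> F" for e
      proof -
        have "e \<in> B" using that F by auto
        have "inner (Rep_hs A e) (Rep_hs K e) \<le> norm (Rep_hs A e) * norm (Rep_hs K e)"
          by (rule norm_cauchy_schwarz)
        also have "\<dots> \<le> norm (Rep_hs A e) * 1"
          using norm_blinfun[of "Rep_hs K" e] K n1[OF \<open>e \<in> B\<close>] by (intro mult_left_mono) auto
        finally show ?thesis using s[OF \<open>e \<in> B\<close>] by simp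
      qed
      hence "(\<Sum>e\<in>F. inner (Rep_hs A e) (Rep_hs K e)) \<le> (\<Sum>e\<in>F. s e)" by (rule sum_mono)
      also have "\<dots> \<le> t" using fin[OF F] real by simp
      finally show ?thesis .
    qed
    hence "inner A K \<le> t" by (rule has_sum_le_finite_sums[OF hs_inner_has_sum[OF B]])
    thus ?thesis using real by (simp add: ennreal_leI)
  qed simp
qed

lemma inner_sgn_self: "inner x (sgn x) = norm (x :: 'z::real_inner)"
  by (cases "x = 0") (simp_all add: sgn_div_norm dot_square_norm power2_eq_square)

text \<open>
  The test operator mapping \<open>e\<close> to the direction of \<open>A e\<close>, for \<open>e\<close> in a finite
  set of singular vectors, recovers the corresponding partial sum of singular values.
\<close>

lemma trace_norm_le_dual:
  fixes A :: "'h::{real_inner,banach} hs"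
  assumes dual: "\<And>K. norm (Rep_hs K) \<le> 1 \<Longrightarrow> inner A K \<le> t"
  shows "trace_norm (Rep_hs A) \<le> ennreal t"
proof (rule singular_value_decomposition[of A])
  fix B s
  assume B: "orthonormal_basis B" and s: "\<And>e. e \<in> B \<Longrightarrow> norm (Rep_hs A e) = s e"
    and orth: "\<And>e f. e \<in> B \<Longrightarrow> f \<in> B \<Longrightarrow> e \<noteq> f \<Longrightarrow> inner (Rep_hs A e) (Rep_hs A f) = 0"
    and nn: "nonneg_definite (op_sqrt (op_sqrt (blinfun_adjoint (Rep_hs A) o\<^sub>L Rep_hs A)))"
    and S: "\<And>e. e \<in> B \<Longrightarrow> op_sqrt (op_sqrt (blinfun_adjoint (Rep_hs A) o\<^sub>L Rep_hs A)) e = sqrt (s e) *\<^sub>R e"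
  have n1: "norm e = 1" if "e \<in> B" for e
    using that B by (auto simp: orthonormal_basis_def orthonormal_def)
  have s0: "0 \<le> s e" if "e \<in> B" for e using s[OF that] norm_ge_zero by metis
  show ?thesis unfolding trace_norm_def
  proof (rule symmetric_hs_norm_square_le[OF B])
    fix x y
    show "inner (op_sqrt (op_sqrt (blinfun_adjoint (Rep_hs A) o\<^sub>L Rep_hs A)) x) y
        = inner x (op_sqrt (op_sqrt (blinfun_adjoint (Rep_hs A) o\<^sub>L Rep_hs A)) y)"
      using nn unfolding nonneg_definite_def by blast
  next
    fix F assume F: "finite F" "F \<subseteq> B"
    have o: "inner (sgn (Rep_hs A e)) (sgn (Rep_hs A f)) = 0" if "e \<in> F" "f \<in> F" "e \<noteq> f" for e f
      using orth[of e f] that F by (auto simp: sgn_div_norm)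
    have n: "norm (sgn (Rep_hs A e)) \<le> 1" if "e \<in> F" for e by (simp add: norm_sgn)
    from finite_rank_contraction[OF B F, of "\<lambda>e. sgn (Rep_hs A e)", OF o n] obtain K where K: "norm (Rep_hs K) \<le> 1"
      "\<And>A'. inner A' K = (\<Sum>e\<in>F. inner (Rep_hs A' e) (sgn (Rep_hs A e)))" by blast
    have "(\<Sum>e\<in>F. (norm (op_sqrt (op_sqrt (blinfun_adjoint (Rep_hs A) o\<^sub>L Rep_hs A)) e))\<^sup>2) = (\<Sum>e\<in>F. s e)"
      using F by (intro sum.cong) (auto simp: S n1 s0 subset_iff)
    also have "\<dots> = (\<Sum>e\<in>F. inner (Rep_hs A e) (sgn (Rep_hs A e)))"
    proof (rule sum.cong)
      fix e assume "e \<in> F"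
      hence "s e = norm (Rep_hs A e)" using s F by auto
      also have "\<dots> = inner (Rep_hs A e) (sgn (Rep_hs A e))"
        by (rule inner_sgn_self[symmetric])
      finally show "s e = inner (Rep_hs A e) (sgn (Rep_hs A e))" .
    qed simp
    also have "\<dots> \<le> t" using dual[OF K(1)] K(2)[of A] by simp
    finally show "(\<Sum>e\<in>F. (norm (op_sqrt (op_sqrt (blinfun_adjoint (Rep_hs A) o\<^sub>L Rep_hs A)) e))\<^sup>2) \<le> t" .
  qed
qed

lemma trace_norm_le_iff:
  fixes A :: "'h::{real_inner,banach} hs"
  assumes "0 \<le> t"
  shows "trace_norm (Rep_hs A) \<le> ennreal t \<longleftrightarrow> (\<forall>K. norm (Rep_hs K) \<le> 1 \<longrightarrow> inner A K \<le> t)"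
proof
  assume "trace_norm (Rep_hs A) \<le> ennreal t"
  hence "ennreal (inner A K) \<le> ennreal t" if "norm (Rep_hs K) \<le> 1" for K
    using inner_le_trace_norm[OF that, of A] by (rule order_trans[rotated])
  thus "\<forall>K. norm (Rep_hs K) \<le> 1 \<longrightarrow> inner A K \<le> t" using assms by (simp add: ennreal_le_iff)
qed (use trace_norm_le_dual in blast)

lemma trace_class_iff: "trace_class (Rep_hs A) \<longleftrightarrow> trace_norm (Rep_hs A) < \<infinity>"
  using hilbert_schmidt_imp_compact[of "Rep_hs A"] Rep_hs[of A] by (auto simp: trace_class_def)

lemma trace_norm_add_le:
  "trace_norm (Rep_hs (A + B)) \<le> trace_norm (Rep_hs A) + trace_norm (Rep_hs B)"
proof (cases "trace_norm (Rep_hs A)"; cases "trace_norm (Rep_hs B)")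
  fix a b assume a: "0 \<le> a" "trace_norm (Rep_hs A) = ennreal a" and b: "0 \<le> b" "trace_norm (Rep_hs B) = ennreal b"
  have "\<forall>K. norm (Rep_hs K) \<le> 1 \<longrightarrow> inner A K \<le> a" "\<forall>K. norm (Rep_hs K) \<le> 1 \<longrightarrow> inner B K \<le> b"
    using trace_norm_le_iff[OF a(1), of A] trace_norm_le_iff[OF b(1), of B] a b by auto
  hence "trace_norm (Rep_hs (A + B)) \<le> ennreal (a + b)"
    by (intro trace_norm_le_dual) (simp add: inner_add_left add_mono)
  thus ?thesis using a b by simp
qed auto

lemma trace_norm_uminus_le: "trace_norm (Rep_hs (- A)) \<le> trace_norm (Rep_hs A)"
proof (cases "trace_norm (Rep_hs A)")
  case (real a)
  hence *: "\<forall>K. norm (Rep_hs K) \<le> 1 \<longrightarrow> inner A K \<le> a" using trace_norm_le_iff[of a A] by auto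
  have "inner (- A) K \<le> a" if "norm (Rep_hs K) \<le> 1" for K
    using *[rule_format, of "- K"] that by (simp add: uminus_hs.rep_eq)
  thus ?thesis unfolding real by (rule trace_norm_le_dual)
qed simp

lemma trace_norm_diff_le:
  "trace_norm (Rep_hs (A - B)) \<le> trace_norm (Rep_hs A) + trace_norm (Rep_hs B)"
  using order_trans[OF trace_norm_add_le[of A "- B"] add_left_mono[OF trace_norm_uminus_le[of B]]]
  by simp

lemma trace_norm_0: "trace_norm (Rep_hs 0) = 0"
  using trace_norm_le_dual[of 0 0] by simp

lemma trace_norm_sum_le:
  "trace_norm (Rep_hs (\<Sum>i\<in>I. A i)) \<le> (\<Sum>i\<in>I. trace_norm (Rep_hs (A i)))"
proof (induction I rule: infinite_finite_induct)
  case (insert i I)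
  thus ?case using order_trans[OF trace_norm_add_le[of "A i" "sum A I"] add_left_mono] by simp
qed (simp_all add: trace_norm_0)

lemma trace_norm_eq_0D:
  assumes "trace_norm (Rep_hs A) = 0"
  shows "A = 0"
proof -
  have le: "\<forall>K. norm (Rep_hs K) \<le> 1 \<longrightarrow> inner A K \<le> 0" using trace_norm_le_iff[of 0 A] assms by simp
  have "norm (Rep_hs (sgn A)) \<le> 1" using norm_Rep_hs_le[of "sgn A"] by (simp add: norm_sgn split: if_splits)
  hence "inner A (sgn A) \<le> 0" using le by blast
  thus ?thesis by (simp add: inner_sgn_self)
qed

text \<open>
  Lower semicontinuity of the trace norm in the Hilbert-Schmidt topology: the sublevel set is an intersection of closed
  half-spaces.
\<close>

lemma closed_trace_norm_le:
  assumes "0 \<le> t"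
  shows "closed {A :: 'h::{real_inner,banach} hs. trace_norm (Rep_hs A) \<le> ennreal t}"
proof -
  have "{A :: 'h hs. trace_norm (Rep_hs A) \<le> ennreal t} = (\<Inter>K\<in>{K. norm (Rep_hs K) \<le> 1}. {A. inner A K \<le> t})"
    using trace_norm_le_iff[OF assms] by auto
  moreover have "closed {A. inner A K \<le> t}" for K :: "'h hs"
    by (intro closed_Collect_le continuous_intros)
  ultimately show ?thesis by (simp add: closed_INT)
qed

lemma borel_measurable_trace_norm: "(\<lambda>A. trace_norm (Rep_hs A)) \<in> borel_measurable borel"
proof (rule borel_measurableI_le)
  fix y :: ennreal
  show "{A \<in> space borel. trace_norm (Rep_hs A) \<le> y} \<in> sets borel"
    using closed_trace_norm_le by (cases y) (auto intro: borel_closed)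
qed

text \<open>
  Test against each contraction \<open>K\<close>; this reduces the claim to integrals of real functions, and the trace
  norm of \<open>f\<close> itself never has to be integrated.
\<close>

lemma trace_norm_integral_le:
  fixes f :: "'n::euclidean_space \<Rightarrow> 'h::{real_inner,banach} hs"
  assumes f: "(f has_integral I) S" and b: "(b has_integral J) S"
    and le: "\<And>x. x \<in> S \<Longrightarrow> trace_norm (Rep_hs (f x)) \<le> ennreal (b x)" and b0: "\<And>x. x \<in> S \<Longrightarrow> 0 \<le> b x"
  shows "trace_norm (Rep_hs I) \<le> ennreal J"
proof (rule trace_norm_le_dual)
  fix K :: "'h hs" assume K: "norm (Rep_hs K) \<le> 1"
  have "((\<lambda>x. inner (f x) K) has_integral inner I K) S"
    using has_integral_linear[OF f bounded_linear_inner_left] by (simp add: comp_def)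
  thus "inner I K \<le> J" by (rule has_integral_le[OF _ b]) (use le b0 K trace_norm_le_iff in blast)
qed

section \<open>The Powers-Stormer inequality\<close>

lemma nonneg_compact_sqrt:
  fixes A :: "'h::{real_inner,banach} \<Rightarrow>\<^sub>L 'h"
  assumes "nonneg_definite A" "compact_operator A"
  shows "nonneg_definite (op_sqrt A)" "op_sqrt A o\<^sub>L op_sqrt A = A" "op_sqrt (A o\<^sub>L A) = A"
proof -
  have "nonneg_definite (op_sqrt A) \<and> op_sqrt A o\<^sub>L op_sqrt A = A \<and> op_sqrt (A o\<^sub>L A) = A"
  proof (rule nonneg_compact_eigenbasis[OF assms(2,1)])
    fix B s assume B: "orthonormal_basis B" and s: "\<And>e. e \<in> B \<Longrightarrow> A e = s e *\<^sub>R e"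
      and s0: "\<And>e. e \<in> B \<Longrightarrow> 0 \<le> s e"
    have AA: "(A o\<^sub>L A) e = (s e)\<^sup>2 *\<^sub>R e" if "e \<in> B" for e
      using s[OF that] by (simp add: blinfun.scaleR_right power2_eq_square)
    have "op_sqrt (A o\<^sub>L A) = A"
    proof (rule blinfun_eq_on_basis[OF B])
      fix e assume e: "e \<in> B"
      have "op_sqrt (A o\<^sub>L A) e = sqrt ((s e)\<^sup>2) *\<^sub>R e"
        by (rule op_sqrt_diagonal(3)[OF B AA _ e]) simp_all
      thus "op_sqrt (A o\<^sub>L A) e = A e" using s[OF e] s0[OF e] by simp
    qed
    thus ?thesis using op_sqrt_diagonal(1,2)[OF B s s0] by blast
  qed
  thus "nonneg_definite (op_sqrt A)" "op_sqrt A o\<^sub>L op_sqrt A = A" "op_sqrt (A o\<^sub>L A) = A"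
    by blast+
qed

text \<open>
  For nonnegative \<open>A\<close> the operator \<open>\<surd>(A\<^sup>* A)\<close> is \<open>A\<close> itself, so the
  trace norm is the squared Hilbert-Schmidt norm of \<open>op_sqrt A\<close>.
\<close>

lemma hilbert_schmidt_op_sqrt:
  fixes A :: "'h::{real_inner,banach} \<Rightarrow>\<^sub>L 'h"
  assumes nn: "nonneg_definite A" and tc: "trace_class A"
  shows "hilbert_schmidt (op_sqrt A)"
proof -
  have "blinfun_adjoint A = A"
    by (rule blinfun_adjoint_eq) (use nn in \<open>unfold nonneg_definite_def, blast\<close>)
  hence "trace_norm A = (hs_norm (op_sqrt A))\<^sup>2"
    using nonneg_compact_sqrt(3)[OF nn] tc by (simp add: trace_norm_def trace_class_def)
  thus ?thesis using tc by (auto simp: trace_class_def hs_norm_def split: if_splits)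
qed

text \<open>
  Let \<open>R\<close> and \<open>S\<close> be the two square roots and diagonalize \<open>R - S\<close>. For a unit
  eigenvector \<open>e\<close> with eigenvalue \<open>s\<close>,
  \<open>\<langle>(A - B) e, e\<rangle> = \<langle>R e, R e\<rangle> - \<langle>S e, S e\<rangle> = \<langle>(R - S) e, (R + S) e\<rangle> = s \<langle>(R + S) e, e\<rangle>\<close>,
  and \<open>\<langle>(R + S) e, e\<rangle> \<ge> \<bar>\<langle>(R - S) e, e\<rangle>\<bar> = \<bar>s\<bar>\<close>
  since \<open>R\<close> and \<open>S\<close> are nonnegative. Hence
  \<open>s\<^sup>2 \<le> \<bar>\<langle>(A - B) e, e\<rangle>\<bar>\<close>. The sum of the \<open>s\<^sup>2\<close> is
  the squared Hilbert-Schmidt norm of \<open>R - S\<close>, and a finite sum of the right-hand sides is the inner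
  product of \<open>A - B\<close> with a contraction that is diagonal with entries \<open>\<plusminus>1\<close> or
  \<open>0\<close>.
\<close>

theorem powers_stormer:
  fixes A B :: "'h::{real_inner,banach} hs"
  assumes A: "nonneg_definite (Rep_hs A)" "trace_class (Rep_hs A)"
    and B: "nonneg_definite (Rep_hs B)" "trace_class (Rep_hs B)"
  shows "(hs_norm (op_sqrt (Rep_hs A) - op_sqrt (Rep_hs B)))\<^sup>2 \<le> trace_norm (Rep_hs (A - B))"
proof (cases "trace_norm (Rep_hs (A - B))")
  case (real t)
  define R where "R = op_sqrt (Rep_hs A)"
  define S where "S = op_sqrt (Rep_hs B)"
  have cA: "compact_operator (Rep_hs A)" and cB: "compact_operator (Rep_hs B)"
    using A B by (auto simp: trace_class_def)
  have R: "nonneg_definite R" "R o\<^sub>L R = Rep_hs A" unfolding R_def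
    by (rule nonneg_compact_sqrt[OF A(1) cA])+
  have S: "nonneg_definite S" "S o\<^sub>L S = Rep_hs B" unfolding S_def
    by (rule nonneg_compact_sqrt[OF B(1) cB])+
  have Rs: "inner (R x) y = inner x (R y)" and Ss: "inner (S x) y = inner x (S y)" for x y
    using R(1) S(1) unfolding nonneg_definite_def by blast+
  have sym: "inner ((R - S) x) y = inner x ((R - S) y)" for x y
    unfolding blinfun.diff_left inner_diff_left inner_diff_right Rs Ss ..
  have "hilbert_schmidt (R - S)" unfolding R_def S_def
    by (intro hilbert_schmidt_diff hilbert_schmidt_op_sqrt A B)
  hence "compact_operator (R - S)" by (rule hilbert_schmidt_imp_compact)
  hence "(hs_norm (R - S))\<^sup>2 \<le> ennreal t"
  proof (rule compact_spectral_theorem[OF _ sym])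
    fix E s assume E: "orthonormal_basis E" and s: "\<And>e. e \<in> E \<Longrightarrow> (R - S) e = s e *\<^sub>R e"
    have o: "orthonormal E" using E by (simp add: orthonormal_basis_def)
    have n1: "norm e = 1" if "e \<in> E" for e using that o by (auto simp: orthonormal_def)
    define q where "q e = inner (Rep_hs (A - B) e) e" for e
    have key: "(s e)\<^sup>2 \<le> \<bar>q e\<bar>" if e: "e \<in> E" for e
    proof -
      define r where "r = inner (R e) e"
      define s' where "s' = inner (S e) e"
      have r0: "0 \<le> r" and s0: "0 \<le> s'"
        using R(1) S(1) unfolding r_def s'_def nonneg_definite_def by blast+
      have "inner ((R - S) e) e = s e" using s[OF e] n1[OF e] by (simp add: dot_square_norm)
      hence rs: "s e = r - s'" by (simp add: r_def s'_def blinfun.diff_left inner_diff_left)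
      have "q e = inner (R (R e) - S (S e)) e"
        by (simp add: q_def minus_hs.rep_eq blinfun.diff_left flip: R(2) S(2))
      also have "\<dots> = inner (R e) (R e) - inner (S e) (S e)"
        by (simp add: inner_diff_left Rs[of "R e"] Ss[of "S e"])
      also have "\<dots> = inner ((R - S) e) (R e + S e)"
        by (simp add: blinfun.diff_left inner_diff_left inner_add_right inner_commute[of "S e" "R e"])
      also have "\<dots> = s e * (r + s')"
        by (simp add: s[OF e] r_def s'_def inner_add_right inner_commute distrib_left)
      finally have "\<bar>q e\<bar> = \<bar>s e\<bar> * (r + s')" using r0 s0 by (simp add: abs_mult)
      moreover have "\<bar>s e\<bar> * \<bar>s e\<bar> \<le> \<bar>s e\<bar> * (r + s')"
        unfolding rs using r0 s0 by (intro mult_left_mono) auto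
      ultimately show ?thesis by (simp add: power2_eq_square)
    qed
    show "(hs_norm (R - S))\<^sup>2 \<le> ennreal t"
    proof (rule symmetric_hs_norm_square_le[OF E sym])
      fix F assume F: "finite F" "F \<subseteq> E"
      have og: "inner (sgn (q e) *\<^sub>R e) (sgn (q f) *\<^sub>R f) = 0" if "e \<in> F" "f \<in> F" "e \<noteq> f" for e f
        using orthonormal_inner[OF o, of e f] that F(2) by auto
      have ng: "norm (sgn (q e) *\<^sub>R e) \<le> 1" if "e \<in> F" for e
        using n1[of e] that F(2) by (auto simp: abs_sgn_eq)
      obtain K where K: "norm (Rep_hs K) \<le> 1"
        and AK: "\<And>A. inner A K = (\<Sum>e\<in>F. inner (Rep_hs A e) (sgn (q e) *\<^sub>R e))"
        using finite_rank_contraction[OF E F, of "\<lambda>e. sgn (q e) *\<^sub>R e", OF og ng] by blast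
      have "(\<Sum>e\<in>F. (norm ((R - S) e))\<^sup>2) = (\<Sum>e\<in>F. (s e)\<^sup>2)"
        using F by (intro sum.cong) (auto simp: s n1 subset_iff simp del: minus_blinfun.rep_eq)
      also have "\<dots> \<le> (\<Sum>e\<in>F. \<bar>q e\<bar>)" using F key by (intro sum_mono) auto
      also have "\<dots> = inner (A - B) K"
        unfolding AK by (intro sum.cong) (auto simp: q_def[symmetric] abs_sgn)
      also have "\<dots> \<le> t"
        using inner_le_trace_norm[OF K, of "A - B"] real by simp
      finally show "(\<Sum>e\<in>F. (norm ((R - S) e))\<^sup>2) \<le> t" .
    qed
  qed
  thus ?thesis by (simp only: R_def S_def real)
qed simp

section \<open>Operators that are bounded in trace norm\<close>

text \<open>
  Boundedness is what makes the supremum of quotients an upper bound for each of them; the quotient at \<open>0\<close>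
  is \<open>0\<close>, which makes the supremum nonnegative.
\<close>

lemma trace_class_onorm_upper:
  fixes C :: "'h::{real_inner,banach} hs \<Rightarrow>\<^sub>L 'h hs"
  assumes C: "bounded_on_trace_class C" and A: "trace_class (Rep_hs A)"
  shows "trace_norm (Rep_hs (C A)) \<le> ennreal (trace_class_onorm C) * trace_norm (Rep_hs A)"
    and "0 \<le> trace_class_onorm C"
proof -
  let ?r = "\<lambda>A. enn2real (trace_norm (Rep_hs (C A))) / enn2real (trace_norm (Rep_hs A))"
  obtain K where K: "\<And>A. trace_class (Rep_hs A) \<Longrightarrow>
      enn2real (trace_norm (Rep_hs (C A))) \<le> K * enn2real (trace_norm (Rep_hs A))"
    using C unfolding bounded_on_trace_class_def by blast
  have "?r A \<le> max K 0" if "trace_class (Rep_hs A)" for A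
  proof (cases "enn2real (trace_norm (Rep_hs A)) = 0")
    case False
    hence "0 < enn2real (trace_norm (Rep_hs A))" by (simp add: order_less_le)
    hence "?r A \<le> K" using K[OF that] by (simp add: divide_le_eq)
    thus ?thesis by simp
  qed simp
  hence bdd: "bdd_above (?r ` {A. trace_class (Rep_hs A)})" by (intro bdd_aboveI2) auto
  have up: "?r A \<le> trace_class_onorm C" if "trace_class (Rep_hs A)" for A
    unfolding trace_class_onorm_def using that by (intro cSUP_upper bdd) simp
  show o0: "0 \<le> trace_class_onorm C"
    using up[of 0] by (simp add: trace_class_iff trace_norm_0)
  have CA: "trace_class (Rep_hs (C A))" using C A unfolding bounded_on_trace_class_def by blast
  obtain a where a: "trace_norm (Rep_hs A) = ennreal a" "0 \<le> a"
    using A unfolding trace_class_iff by (cases "trace_norm (Rep_hs A)") auto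
  obtain b where b: "trace_norm (Rep_hs (C A)) = ennreal b" "0 \<le> b"
    using CA unfolding trace_class_iff by (cases "trace_norm (Rep_hs (C A))") auto
  show "trace_norm (Rep_hs (C A)) \<le> ennreal (trace_class_onorm C) * trace_norm (Rep_hs A)"
  proof (cases "a = 0")
    case True
    hence "A = 0" using a trace_norm_eq_0D by simp
    thus ?thesis by (simp add: trace_norm_0)
  next
    case False
    hence "b \<le> trace_class_onorm C * a" using up[OF A] a b by (simp add: divide_le_eq)
    thus ?thesis using a b o0 by (simp add: ennreal_leI flip: ennreal_mult)
  qed
qed

lemma bounded_on_trace_class_diff:
  fixes C D :: "'h::{real_inner,banach} hs \<Rightarrow>\<^sub>L 'h hs"
  assumes C: "bounded_on_trace_class C" and D: "bounded_on_trace_class D"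
  shows "bounded_on_trace_class (C - D)"
proof -
  let ?c = "trace_class_onorm C + trace_class_onorm D"
  have le: "trace_norm (Rep_hs ((C - D) A)) \<le> ennreal ?c * trace_norm (Rep_hs A)"
    if A: "trace_class (Rep_hs A)" for A
  proof -
    have "trace_norm (Rep_hs ((C - D) A)) \<le> trace_norm (Rep_hs (C A)) + trace_norm (Rep_hs (D A))"
      unfolding blinfun.diff_left by (rule trace_norm_diff_le)
    also have "\<dots> \<le> ennreal (trace_class_onorm C) * trace_norm (Rep_hs A)
        + ennreal (trace_class_onorm D) * trace_norm (Rep_hs A)"
      by (intro add_mono trace_class_onorm_upper C D A)
    also have "\<dots> = ennreal ?c * trace_norm (Rep_hs A)"
      using trace_class_onorm_upper(2)[OF C A] trace_class_onorm_upper(2)[OF D A]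
      by (simp add: distrib_right)
    finally show ?thesis .
  qed
  show ?thesis unfolding bounded_on_trace_class_def
  proof (intro conjI allI impI exI[of _ ?c])
    fix A :: "'h hs" assume A: "trace_class (Rep_hs A)"
    have fin: "ennreal ?c * trace_norm (Rep_hs A) < \<infinity>"
      using A by (simp add: trace_class_iff ennreal_mult_less_top)
    thus "trace_class (Rep_hs ((C - D) A))"
      using le[OF A] by (simp add: trace_class_iff order_le_less_trans)
    have "enn2real (trace_norm (Rep_hs ((C - D) A))) \<le> enn2real (ennreal ?c * trace_norm (Rep_hs A))"
      using le[OF A] fin by (intro enn2real_mono) auto
    thus "enn2real (trace_norm (Rep_hs ((C - D) A))) \<le> ?c * enn2real (trace_norm (Rep_hs A))"
      using trace_class_onorm_upper(2)[OF C A] trace_class_onorm_upper(2)[OF D A]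
      by (simp add: enn2real_mult del: ennreal_plus)
  qed
qed

section \<open>Linear integral equations in trace norm\<close>

text \<open>
  Gronwall's lemma in the form of a comparison with a scalar solution \<open>u\<close> of
  \<open>u = g + c \<integral> u\<close>. The trace norm of \<open>U\<close> is not known to be bounded, so it cannot be
  inserted into a scalar Gronwall inequality. The Picard iterates \<open>P n\<close> started at zero, however, are
  bounded by \<open>u\<close> in trace norm by induction, they converge to \<open>U\<close> in the Hilbert-Schmidt norm,
  and lower semicontinuity carries the bound over to \<open>U\<close>.
\<close>

lemma trace_norm_gronwall:
  fixes D :: "'h::{real_inner,banach} hs \<Rightarrow>\<^sub>L 'h hs" and U G :: "real \<Rightarrow> 'h hs"
  assumes U: "\<And>t. t \<in> {0..T} \<Longrightarrow> ((\<lambda>s. D (U s)) has_integral (U t - G t)) {0..t}"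
    and bU: "\<And>t. t \<in> {0..T} \<Longrightarrow> norm (U t) \<le> M"
    and iG: "G integrable_on {0..T}"
    and D: "\<And>A r. 0 \<le> r \<Longrightarrow> trace_norm (Rep_hs A) \<le> ennreal r \<Longrightarrow> trace_norm (Rep_hs (D A)) \<le> ennreal (c * r)"
    and c: "0 \<le> c"
    and G: "\<And>t. t \<in> {0..T} \<Longrightarrow> 0 \<le> g t \<and> trace_norm (Rep_hs (G t)) \<le> ennreal (g t)"
    and u0: "\<And>t. t \<in> {0..T} \<Longrightarrow> 0 \<le> u t"
    and u: "\<And>t. t \<in> {0..T} \<Longrightarrow> ((\<lambda>s. c * u s) has_integral (u t - g t)) {0..t}"
    and t: "t \<in> {0..T}"
  shows "trace_norm (Rep_hs (U t)) \<le> ennreal (u t)"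
proof -
  define P where "P = rec_nat (\<lambda>_. 0) (\<lambda>n p t. G t + integral {0..t} (\<lambda>s. D (p s)))"
  have P0: "P 0 = (\<lambda>_. 0)" and PS: "P (Suc n) = (\<lambda>t. G t + integral {0..t} (\<lambda>s. D (P n s)))" for n
    by (simp_all add: P_def)
  have DP: "(\<lambda>s. D (P n s)) integrable_on {0..T}" for n
  proof -
    have "P n integrable_on {0..T}"
    proof (induction n)
      case (Suc n)
      hence "(\<lambda>s. D (P n s)) integrable_on {0..T}"
        using integrable_linear[OF Suc blinfun.bounded_linear_right[of D]] by (simp add: comp_def)
      hence "(\<lambda>t. integral {0..t} (\<lambda>s. D (P n s))) integrable_on {0..T}"
        by (rule integrable_continuous_real[OF indefinite_integral_continuous_1])
      thus ?case unfolding PS by (intro integrable_add iG)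
    qed (simp add: P0 integrable_0)
    thus ?thesis
      using integrable_linear[OF _ blinfun.bounded_linear_right[of D]] by (simp add: comp_def)
  qed
  have DPt: "((\<lambda>s. D (P n s)) has_integral integral {0..t} (\<lambda>s. D (P n s))) {0..t}" if "t \<in> {0..T}" for n t
    by (intro integrable_integral integrable_on_subinterval[OF DP]) (use that in auto)
  \<comment> \<open>Each iterate stays below \<open>u\<close> in trace norm because \<open>u\<close> solves the scalar equation.\<close>
  have tnP: "trace_norm (Rep_hs (P n t)) \<le> ennreal (u t)" if "t \<in> {0..T}" for n t
    using that
  proof (induction n arbitrary: t)
    case 0
    thus ?case by (simp add: P0 trace_norm_0)
  next
    case (Suc n)
    have sub: "s \<in> {0..T}" if "s \<in> {0..t}" for s using that Suc.prems by auto
    have int: "trace_norm (Rep_hs (integral {0..t} (\<lambda>s. D (P n s)))) \<le> ennreal (u t - g t)"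
    proof (rule trace_norm_integral_le[OF DPt u])
      show "trace_norm (Rep_hs (D (P n s))) \<le> ennreal (c * u s)" if "s \<in> {0..t}" for s
        by (rule D[OF u0 Suc.IH]) (use sub that in auto)
      show "0 \<le> c * u s" if "s \<in> {0..t}" for s using u0[OF sub[OF that]] c by simp
    qed (use Suc.prems in auto)
    have ge: "0 \<le> u t - g t"
      using u[OF Suc.prems] by (rule has_integral_nonneg) (use u0 sub c in auto)
    have "trace_norm (Rep_hs (P (Suc n) t)) \<le> ennreal (g t) + ennreal (u t - g t)"
      unfolding PS using trace_norm_add_le add_mono[OF conjunct2[OF G[OF Suc.prems]] int]
      by (rule order_trans)
    also have "\<dots> = ennreal (u t)" using ge G[OF Suc.prems] by (simp flip: ennreal_plus)
    finally show ?case .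
  qed
  define d where "d = norm D"
  \<comment> \<open>The usual factorial bound on the Picard error, in the Hilbert-Schmidt norm.\<close>
  have err: "norm (U t - P n t) \<le> M * (inverse (fact n) * (d * t) ^ n)" if "t \<in> {0..T}" for n t
    using that
  proof (induction n arbitrary: t)
    case 0
    thus ?case using bU by (simp add: P0)
  next
    case (Suc n)
    have "((\<lambda>s. D (U s) - D (P n s)) has_integral (U t - G t) - integral {0..t} (\<lambda>s. D (P n s))) {0..t}"
      by (intro has_integral_diff U DPt Suc.prems)
    hence i1: "((\<lambda>s. D (U s - P n s)) has_integral (U t - P (Suc n) t)) {0..t}"
      by (simp add: PS blinfun.diff_right diff_diff_eq)
    have i2: "((\<lambda>s. d * (M * (inverse (fact n) * (d * s) ^ n))) has_integral
        (M * (inverse (fact (Suc n)) * (d * t) ^ Suc n) - M * (inverse (fact (Suc n)) * (d * 0) ^ Suc n))) {0..t}"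
    proof (rule fundamental_theorem_of_calculus)
      show "0 \<le> t" using Suc.prems by simp
      fix s assume "s \<in> {0..t}"
      have "((\<lambda>s. M * (inverse (fact (Suc n)) * (d * s) ^ Suc n)) has_real_derivative
          M * (inverse (fact (Suc n)) * (real (Suc n) * (d * s) ^ n * d))) (at s within {0..t})"
        by (auto intro!: derivative_eq_intros simp del: fact_Suc power_Suc)
      moreover have "M * (inverse (fact (Suc n)) * (real (Suc n) * (d * s) ^ n * d))
          = d * (M * ((inverse (fact (Suc n)) * real (Suc n)) * (d * s) ^ n))"
        by (simp only: mult_ac)
      moreover have "inverse (fact (Suc n)) * real (Suc n) = inverse (fact n :: real)"
        by (simp add: nonzero_inverse_mult_distrib del: of_nat_Suc)
      ultimately show "((\<lambda>s. M * (inverse (fact (Suc n)) * (d * s) ^ Suc n)) has_vector_derivative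
          d * (M * (inverse (fact n) * (d * s) ^ n))) (at s within {0..t})"
        by (simp only: has_real_derivative_iff_has_vector_derivative)
    qed
    have "norm (D (U s - P n s)) \<le> (d * (M * (inverse (fact n) * (d * s) ^ n))) \<bullet> 1" if "s \<in> {0..t}" for s
    proof -
      have "norm (D (U s - P n s)) \<le> d * norm (U s - P n s)" unfolding d_def by (rule norm_blinfun)
      also have "\<dots> \<le> d * (M * (inverse (fact n) * (d * s) ^ n))"
        using that Suc.prems by (intro mult_left_mono Suc.IH) (auto simp: d_def)
      finally show ?thesis by simp
    qed
    from has_integral_norm_bound_integral_component[OF i1 i2 this] show ?case by simp
  qed
  have "(\<lambda>n. M * (inverse (fact n) * (d * t) ^ n)) \<longlonglongrightarrow> M * 0"
    by (intro tendsto_intros summable_LIMSEQ_zero summable_exp)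
  hence "(\<lambda>n. M * (inverse (fact n) * (d * t) ^ n)) \<longlonglongrightarrow> 0" by simp
  hence "(\<lambda>n. U t - P n t) \<longlonglongrightarrow> 0"
    by (rule Lim_null_comparison[rotated]) (rule always_eventually, rule allI, rule err[OF t])
  hence "(\<lambda>n. U t - (U t - P n t)) \<longlonglongrightarrow> U t - 0" by (intro tendsto_intros)
  hence lim: "(\<lambda>n. P n t) \<longlonglongrightarrow> U t" by simp
  have "U t \<in> {A. trace_norm (Rep_hs A) \<le> ennreal (u t)}"
    by (rule closed_sequentially[OF closed_trace_norm_le[OF u0[OF t]] _ lim]) (simp add: tnP[OF t])
  thus ?thesis by simp
qed

text \<open>
  The indicator of \<open>i \<le> N t\<close> is monotone in \<open>t\<close>, hence integrable, and on
  \<open>{0..T}\<close> the path is a finite combination of such indicators.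
\<close>

lemma compound_path_integrable:
  fixes X :: "nat \<Rightarrow> 'b::banach" and N :: "real \<Rightarrow> nat"
  assumes N: "mono_on {0..} N" and T: "0 \<le> T"
  shows "(\<lambda>t. \<Sum>i=1..N t. X i) integrable_on {0..T}"
proof -
  have eq: "(\<Sum>i=1..N t. X i) = (\<Sum>i=1..N T. (if i \<le> N t then 1 else 0) *\<^sub>R X i)" if "t \<in> {0..T}" for t
  proof -
    have "N t \<le> N T" using N that by (auto intro: mono_onD)
    hence "{1..N t} = {1..N T} \<inter> {i. i \<le> N t}" by auto
    hence "(\<Sum>i=1..N t. X i) = (\<Sum>i=1..N T. if i \<le> N t then X i else 0)"
      by (simp add: sum.If_cases)
    also have "\<dots> = (\<Sum>i=1..N T. (if i \<le> N t then 1 else 0) *\<^sub>R X i)" by (intro sum.cong) auto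
    finally show ?thesis .
  qed
  have "(\<lambda>t. (if i \<le> N t then 1 else 0::real)) integrable_on {0..T}" for i
  proof (rule integrable_on_mono_on, rule mono_onI)
    fix r s assume "r \<in> {0..T}" "s \<in> {0..T}" "r \<le> s"
    hence "N r \<le> N s" using N by (auto intro: mono_onD)
    thus "(if i \<le> N r then 1 else 0::real) \<le> (if i \<le> N s then 1 else 0)" by auto
  qed
  hence "(\<lambda>t. (if i \<le> N t then 1 else 0::real) *\<^sub>R X i) integrable_on {0..T}" for i
    by (rule integrable_linear[OF _ bounded_linear_scaleR_left, unfolded comp_def])
  hence "(\<lambda>t. \<Sum>i=1..N T. (if i \<le> N t then 1 else 0::real) *\<^sub>R X i) integrable_on {0..T}"
    by (intro integrable_sum) auto
  thus ?thesis by (rule integrable_eq) (rule eq[symmetric])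
qed

lemma linear_equation_path_regular:
  fixes C :: "'b::banach \<Rightarrow>\<^sub>L 'b" and X :: "nat \<Rightarrow> 'b" and N :: "real \<Rightarrow> nat"
  assumes N: "mono_on {0..} N" and T: "0 \<le> T"
    and V: "\<And>t. 0 \<le> t \<Longrightarrow> ((\<lambda>s. C (V s)) has_integral (V t - v - (\<Sum>i=1..N t. X i))) {0..t}"
  shows "V integrable_on {0..T}" "\<exists>M. \<forall>t\<in>{0..T}. norm (V t) \<le> M"
proof -
  define I where "I t = integral {0..t} (\<lambda>s. C (V s))" for t
  have VI: "V t = v + (\<Sum>i=1..N t. X i) + I t" if "t \<in> {0..T}" for t
    using integral_unique[OF V[of t]] that by (simp add: I_def algebra_simps)
  have "(\<lambda>s. C (V s)) integrable_on {0..T}" using V[OF T] by blast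
  hence cI: "continuous_on {0..T} I" unfolding I_def by (rule indefinite_integral_continuous_1)
  have "(\<lambda>t. v + (\<Sum>i=1..N t. X i) + I t) integrable_on {0..T}"
    by (intro integrable_add compound_path_integrable[OF N T] integrable_continuous_real[OF cI]
        integrable_const_ivl)
  thus "V integrable_on {0..T}" by (rule integrable_eq) (rule VI[symmetric])
  have "bounded (I ` {0..T})"
    by (intro compact_imp_bounded compact_continuous_image cI compact_Icc)
  then obtain J where "\<forall>x\<in>I ` {0..T}. norm x \<le> J" unfolding bounded_iff by blast
  hence J: "norm (I t) \<le> J" if "t \<in> {0..T}" for t using that by blast
  have "norm (V t) \<le> norm v + (\<Sum>i=1..N T. norm (X i)) + J" if t: "t \<in> {0..T}" for t
  proof -
    have "N t \<le> N T" using N t by (auto intro: mono_onD)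
    hence "(\<Sum>i=1..N t. norm (X i)) \<le> (\<Sum>i=1..N T. norm (X i))" by (intro sum_mono2) auto
    hence "norm (\<Sum>i=1..N t. X i) \<le> (\<Sum>i=1..N T. norm (X i))" using norm_sum order_trans by blast
    thus ?thesis unfolding VI[OF t] using J[OF t]
      by (intro order_trans[OF norm_triangle_ineq] add_mono order_trans[OF norm_triangle_ineq]) auto
  qed
  thus "\<exists>M. \<forall>t\<in>{0..T}. norm (V t) \<le> M" by blast
qed

text \<open>
  Two applications of Gronwall's lemma: to \<open>V\<close> with the comparison function
  \<open>r e\<^bsup>ct\<^esup>\<close>, where \<open>r\<close> is the value of the sum in the conclusion, and to
  \<open>V - W\<close> with \<open>\<delta> r t e\<^bsup>ct\<^esup>\<close>, where \<open>\<delta>\<close> is the norm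
  of \<open>C - D\<close>. If that sum is infinite, the claim is trivial except when \<open>\<delta> = 0\<close>,
  because the product is then \<open>0\<close>. In that case \<open>C\<close> and \<open>D\<close> agree along
  \<open>V\<close>, and comparison with \<open>u = 0\<close> shows \<open>V = W\<close>.
\<close>

lemma variance_path_distance:
  fixes C D :: "'h::{real_inner,banach} hs \<Rightarrow>\<^sub>L 'h hs" and V W :: "real \<Rightarrow> 'h hs" and N :: "real \<Rightarrow> nat"
  assumes C: "bounded_on_trace_class C" and D: "bounded_on_trace_class D"
    and N: "mono_on {0..} N"
    and V: "\<And>t. 0 \<le> t \<Longrightarrow> ((\<lambda>s. C (V s)) has_integral (V t - v - (\<Sum>i=1..N t. X i))) {0..t}"
    and W: "\<And>t. 0 \<le> t \<Longrightarrow> ((\<lambda>s. D (W s)) has_integral (W t - v - (\<Sum>i=1..N t. X i))) {0..t}"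
    and tc: "\<And>t. 0 \<le> t \<Longrightarrow> trace_class (Rep_hs (V t))"
    and t: "t \<in> {0..T}" and T: "0 < T"
  shows "trace_norm (Rep_hs (V t - W t)) \<le>
      ennreal (T * exp (T * max (trace_class_onorm C) (trace_class_onorm D)))
      * (trace_norm (Rep_hs v) + (\<Sum>i=1..N T. trace_norm (Rep_hs (X i)))) * ennreal (trace_class_onorm (C - D))"
proof -
  define c where "c = max (trace_class_onorm C) (trace_class_onorm D)"
  define \<delta> where "\<delta> = trace_class_onorm (C - D)"
  define k where "k = trace_norm (Rep_hs v) + (\<Sum>i=1..N T. trace_norm (Rep_hs (X i)))"
  have T0: "0 \<le> T" using T by simp
  have CD: "bounded_on_trace_class (C - D)" by (rule bounded_on_trace_class_diff[OF C D])
  have tc0: "trace_class (Rep_hs (0 :: 'h hs))" by (simp add: trace_class_iff trace_norm_0)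
  have c0: "0 \<le> c" and \<delta>0: "0 \<le> \<delta>"
    using trace_class_onorm_upper(2)[OF C tc0] trace_class_onorm_upper(2)[OF CD tc0]
    by (auto simp: c_def \<delta>_def)
  have bd: "trace_norm (Rep_hs (E A)) \<le> ennreal (c' * r)"
    if E: "bounded_on_trace_class E" and c': "trace_class_onorm E \<le> c'"
      and r: "0 \<le> r" "trace_norm (Rep_hs A) \<le> ennreal r" for E :: "'h hs \<Rightarrow>\<^sub>L 'h hs" and A c' r
  proof -
    have A: "trace_class (Rep_hs A)" using r(2) by (simp add: trace_class_iff order_le_less_trans)
    have "trace_norm (Rep_hs (E A)) \<le> ennreal (trace_class_onorm E) * trace_norm (Rep_hs A)"
      by (rule trace_class_onorm_upper(1)[OF E A])
    also have "\<dots> \<le> ennreal c' * ennreal r" using c' r by (intro mult_mono ennreal_leI) auto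
    also have "\<dots> = ennreal (c' * r)"
      using trace_class_onorm_upper(2)[OF E A] c' r by (simp add: ennreal_mult)
    finally show ?thesis .
  qed
  have bC: "trace_norm (Rep_hs (C A)) \<le> ennreal (c * r)" if "0 \<le> r" "trace_norm (Rep_hs A) \<le> ennreal r" for A r
    by (rule bd[OF C _ that]) (simp add: c_def)
  have bD: "trace_norm (Rep_hs (D A)) \<le> ennreal (c * r)" if "0 \<le> r" "trace_norm (Rep_hs A) \<le> ennreal r" for A r
    by (rule bd[OF D _ that]) (simp add: c_def)
  have bCD: "trace_norm (Rep_hs ((C - D) A)) \<le> ennreal (\<delta> * r)" if "0 \<le> r" "trace_norm (Rep_hs A) \<le> ennreal r" for A r
    by (rule bd[OF CD _ that]) (simp add: \<delta>_def)
  note regV = linear_equation_path_regular[OF N T0 V]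
  note regW = linear_equation_path_regular[OF N T0 W]
  obtain MV where MV: "\<And>t. t \<in> {0..T} \<Longrightarrow> norm (V t) \<le> MV" using regV(2) by blast
  obtain MW where MW: "\<And>t. t \<in> {0..T} \<Longrightarrow> norm (W t) \<le> MW" using regW(2) by blast
  have bVW: "norm (V t - W t) \<le> MV + MW" if "t \<in> {0..T}" for t
    using norm_triangle_ineq4[of "V t" "W t"] MV[OF that] MW[OF that] by linarith
  define G where "G t = integral {0..t} (\<lambda>s. (C - D) (V s))" for t
  have iCD: "(\<lambda>s. (C - D) (V s)) integrable_on {0..T}"
    using integrable_linear[OF regV(1) blinfun.bounded_linear_right[of "C - D"]] by (simp add: comp_def)
  have Gt: "((\<lambda>s. (C - D) (V s)) has_integral G t) {0..t}" if "t \<in> {0..T}" for t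
    unfolding G_def by (intro integrable_integral integrable_on_subinterval[OF iCD]) (use that in auto)
  have iG: "G integrable_on {0..T}"
    unfolding G_def by (rule integrable_continuous_real[OF indefinite_integral_continuous_1[OF iCD]])
  have dist: "((\<lambda>s. D (V s - W s)) has_integral ((V t - W t) - G t)) {0..t}" if t: "t \<in> {0..T}" for t
  proof -
    have "0 \<le> t" using t by simp
    from has_integral_diff[OF has_integral_diff[OF V[OF this] W[OF this]] Gt[OF t]]
    show ?thesis by (simp add: blinfun.diff_left blinfun.diff_right algebra_simps)
  qed
  \<comment> \<open>If \<open>\<delta> = 0\<close>, the bound is \<open>0\<close> even when \<open>k\<close> is infinite.\<close>
  consider "\<delta> = 0" | "0 < \<delta>" "k = \<infinity>" | r where "k = ennreal r" "0 \<le> r"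
    using \<delta>0 by (cases k) (auto simp: less_eq_real_def)
  hence "trace_norm (Rep_hs (V t - W t)) \<le> ennreal (T * exp (T * c)) * k * ennreal \<delta>"
  proof cases
    case 1
    have "(C - D) (V s) = 0" if "0 \<le> s" for s
    proof -
      obtain r where "0 \<le> r" "trace_norm (Rep_hs (V s)) = ennreal r"
        using tc[of s] \<open>0 \<le> s\<close> by (cases "trace_norm (Rep_hs (V s))") (auto simp: trace_class_iff)
      hence "trace_norm (Rep_hs ((C - D) (V s))) = 0" using bCD[of r "V s"] 1 by simp
      thus ?thesis by (rule trace_norm_eq_0D)
    qed
    hence G0: "G t = 0" for t
      unfolding G_def by (subst integral_cong[where g="\<lambda>_. 0"]) auto
    have "trace_norm (Rep_hs (V t - W t)) \<le> ennreal 0"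
      by (rule trace_norm_gronwall[where G=G and u="\<lambda>_. 0" and g="\<lambda>_. 0", OF dist bVW iG bD c0 _ _ _ t])
         (auto simp: G0 trace_norm_0)
    thus ?thesis by simp
  next
    case 2
    thus ?thesis using T by (simp add: ennreal_mult_top ennreal_top_mult)
  next
    case (3 r)
    define F where "F t = v + (\<Sum>i=1..N t. X i)" for t
    have F: "trace_norm (Rep_hs (F t)) \<le> ennreal r" if "t \<in> {0..T}" for t
    proof -
      have "N t \<le> N T" using N that by (auto intro: mono_onD)
      have "trace_norm (Rep_hs (F t)) \<le> trace_norm (Rep_hs v) + trace_norm (Rep_hs (\<Sum>i=1..N t. X i))"
        unfolding F_def by (rule trace_norm_add_le)
      also have "\<dots> \<le> trace_norm (Rep_hs v) + (\<Sum>i=1..N t. trace_norm (Rep_hs (X i)))"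
        by (intro add_left_mono trace_norm_sum_le)
      also have "\<dots> \<le> k" unfolding k_def using \<open>N t \<le> N T\<close> by (intro add_left_mono sum_mono2) auto
      finally show ?thesis using 3 by simp
    qed
    have exp_int: "((\<lambda>s. c * (r * exp (c * s))) has_integral (r * exp (c * t) - r)) {0..t}" if "0 \<le> t" for t
    proof -
      have "((\<lambda>s. c * (r * exp (c * s))) has_integral (r * exp (c * t) - r * exp (c * 0))) {0..t}"
        by (rule fundamental_theorem_of_calculus[OF that])
           (auto intro!: derivative_eq_intros simp flip: has_real_derivative_iff_has_vector_derivative)
      thus ?thesis by simp
    qed
    have V_bound: "trace_norm (Rep_hs (V t)) \<le> ennreal (r * exp (c * t))" if t: "t \<in> {0..T}" for t
    proof (rule trace_norm_gronwall[where G=F and g="\<lambda>_. r" and u="\<lambda>t. r * exp (c * t)", OF _ MV _ bC c0 _ _ _ t])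
      show "((\<lambda>s. C (V s)) has_integral (V t - F t)) {0..t}" if "t \<in> {0..T}" for t
        using V[of t] that by (simp add: F_def diff_diff_eq)
      show "F integrable_on {0..T}" unfolding F_def
        by (intro integrable_add compound_path_integrable[OF N T0] integrable_const_ivl)
      show "0 \<le> r \<and> trace_norm (Rep_hs (F t)) \<le> ennreal r" if "t \<in> {0..T}" for t using F[OF that] 3 by simp
      show "((\<lambda>s. c * (r * exp (c * s))) has_integral (r * exp (c * t) - r)) {0..t}" if "t \<in> {0..T}" for t
        using exp_int that by simp
    qed (use 3 in auto)
    define g where "g t = integral {0..t} (\<lambda>s. \<delta> * (r * exp (c * s)))" for t
    have g: "((\<lambda>s. \<delta> * (r * exp (c * s))) has_integral g t) {0..t}" for t
      unfolding g_def by (intro integrable_integral integrable_continuous_real continuous_intros)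
    have W_bound: "trace_norm (Rep_hs (V t - W t)) \<le> ennreal (\<delta> * r * t * exp (c * t))"
    proof (rule trace_norm_gronwall[where G=G and g=g and u="\<lambda>t. \<delta> * r * t * exp (c * t)", OF dist bVW iG bD c0 _ _ _ t])
      fix t assume t: "t \<in> {0..T}"
      have "trace_norm (Rep_hs (G t)) \<le> ennreal (g t)"
        by (rule trace_norm_integral_le[OF Gt[OF t] g])
           (use t V_bound bCD \<delta>0 3 in auto)
      moreover have "0 \<le> g t" using g by (rule has_integral_nonneg) (use \<delta>0 3 in auto)
      ultimately show "0 \<le> g t \<and> trace_norm (Rep_hs (G t)) \<le> ennreal (g t)" by simp
      show "0 \<le> \<delta> * r * t * exp (c * t)" using \<delta>0 3 t by simp
      \<comment> \<open>The integrand is the derivative of \<open>\<delta> r s e\<^bsup>cs\<^esup>\<close> by the product rule.\<close>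
      have "((\<lambda>s. \<delta> * (r * exp (c * s)) + c * (\<delta> * r * s * exp (c * s))) has_integral
          (\<delta> * r * t * exp (c * t) - \<delta> * r * 0 * exp (c * 0))) {0..t}"
        by (rule fundamental_theorem_of_calculus)
           (use t in \<open>auto intro!: derivative_eq_intros simp: algebra_simps simp flip: has_real_derivative_iff_has_vector_derivative\<close>)
      from has_integral_diff[OF this g[of t]]
      show "((\<lambda>s. c * (\<delta> * r * s * exp (c * s))) has_integral (\<delta> * r * t * exp (c * t) - g t)) {0..t}"
        by simp
    qed
    have "\<delta> * r * t * exp (c * t) \<le> \<delta> * r * T * exp (c * T)"
      using t \<delta>0 3 c0 by (intro mult_mono mult_nonneg_nonneg) (auto intro: mult_left_mono)
    hence "trace_norm (Rep_hs (V t - W t)) \<le> ennreal (\<delta> * r * T * exp (c * T))"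
      using W_bound by (rule order_trans[OF _ ennreal_leI, rotated])
    also have "\<dots> = ennreal (T * exp (T * c)) * k * ennreal \<delta>"
      using 3 \<delta>0 T0 by (simp add: mult_ac flip: ennreal_mult)
    finally show ?thesis .
  qed
  thus ?thesis by (simp only: c_def \<delta>_def k_def)
qed

section \<open>The mean of a compound Poisson sum\<close>

lemma nn_integral_poisson_pmf:
  assumes "0 < r"
  shows "(\<integral>\<^sup>+ n. of_nat n \<partial>measure_pmf (poisson_pmf r)) = ennreal r"
proof -
  have "(\<lambda>k. r ^ k /\<^sub>R fact k) sums exp r" by (rule exp_converges)
  hence "(\<lambda>k. (r * exp (- r)) * (r ^ k /\<^sub>R fact k)) sums ((r * exp (- r)) * exp r)" by (rule sums_mult)
  moreover have "(r * exp (- r)) * exp r = r" by (simp add: exp_minus)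
  moreover have "(r * exp (- r)) * (r ^ k /\<^sub>R fact k) = r ^ Suc k / fact (Suc k) * exp (- r) * real (Suc k)" for k
    by (simp add: divide_simps del: of_nat_Suc)
  ultimately have "(\<lambda>k. r ^ Suc k / fact (Suc k) * exp (- r) * real (Suc k)) sums r" by simp
  hence s: "(\<lambda>k. r ^ k / fact k * exp (- r) * real k) sums r"
    by (subst (asm) sums_Suc_iff) simp
  have "(\<integral>\<^sup>+ n. of_nat n \<partial>measure_pmf (poisson_pmf r)) = (\<Sum>k. ennreal (r ^ k / fact k * exp (- r)) * of_nat k)"
    unfolding nn_integral_measure_pmf nn_integral_count_space_nat using assms by simp
  also have "\<dots> = (\<Sum>k. ennreal (r ^ k / fact k * exp (- r) * real k))"
    using assms by (intro suminf_cong) (simp add: ennreal_of_nat_eq_real_of_nat flip: ennreal_mult)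
  also have "\<dots> = ennreal r" using assms by (intro suminf_ennreal_eq s) simp
  finally show ?thesis .
qed

lemma poisson_process_mean:
  assumes M: "prob_space M" and r: "0 < r" and N: "poisson_process M r N" and T: "0 < T"
  shows "(\<integral>\<^sup>+ \<omega>. of_nat (N T \<omega>) \<partial>M) = ennreal (r * T)"
proof -
  have [measurable]: "N t \<in> measurable M (count_space UNIV)" if "0 \<le> t" for t
    using N that by (auto simp: poisson_process_def)
  have N0: "AE \<omega> in M. N 0 \<omega> = 0" using N unfolding poisson_process_def by (auto elim: AE_mp)
  have "\<forall>s t. 0 \<le> s \<and> s < t \<longrightarrow>
      distr M (count_space UNIV) (\<lambda>\<omega>. N t \<omega> - N s \<omega>) = measure_pmf (poisson_pmf (r * (t - s)))"
    using N unfolding poisson_process_def by blast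
  hence d: "distr M (count_space UNIV) (\<lambda>\<omega>. N T \<omega> - N 0 \<omega>) = measure_pmf (poisson_pmf (r * T))"
    using T by (metis diff_zero order_refl)
  have [measurable]: "N T \<in> measurable M (count_space UNIV)" "N 0 \<in> measurable M (count_space UNIV)"
    using T by simp_all
  \<comment> \<open>Only the laws of increments are given, so \<open>N T\<close> is replaced by its increment from \<open>0\<close>.\<close>
  have "(\<integral>\<^sup>+ \<omega>. of_nat (N T \<omega>) \<partial>M) = (\<integral>\<^sup>+ \<omega>. of_nat (N T \<omega> - N 0 \<omega>) \<partial>M)"
    using N0 by (intro nn_integral_cong_AE) auto
  also have "\<dots> = (\<integral>\<^sup>+ n. of_nat n \<partial>distr M (count_space UNIV) (\<lambda>\<omega>. N T \<omega> - N 0 \<omega>))"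
    by (rule nn_integral_distr[symmetric]) measurable
  also have "\<dots> = ennreal (r * T)" unfolding d using r T by (intro nn_integral_poisson_pmf) simp
  finally show ?thesis .
qed

text \<open>
  Wald's identity: write the random sum as a series over \<open>i\<close> of the indicators of \<open>i \<le> N\<close>
  times \<open>Z i\<close>, integrate termwise, and resum the probabilities of \<open>i \<le> N\<close> to the mean of
  \<open>N\<close>.
\<close>

lemma wald_nn_integral:
  fixes N :: "'w \<Rightarrow> nat" and Z :: "nat \<Rightarrow> 'w \<Rightarrow> ennreal"
  assumes N [measurable]: "N \<in> measurable M (count_space UNIV)"
    and Z [measurable]: "\<And>i. Z i \<in> borel_measurable M"
    and ind: "\<And>i. 1 \<le> i \<Longrightarrow>
      (\<integral>\<^sup>+ \<omega>. indicator {\<omega>\<in>space M. i \<le> N \<omega>} \<omega> * Z i \<omega> \<partial>M) = (\<integral>\<^sup>+ \<omega>. indicator {\<omega>\<in>space M. i \<le> N \<omega>} \<omega> \<partial>M) * m"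
  shows "(\<integral>\<^sup>+ \<omega>. (\<Sum>i=1..N \<omega>. Z i \<omega>) \<partial>M) = (\<integral>\<^sup>+ \<omega>. of_nat (N \<omega>) \<partial>M) * m"
    and "(\<lambda>\<omega>. \<Sum>i=1..N \<omega>. Z i \<omega>) \<in> borel_measurable M"
proof -
  have series: "(\<Sum>i=1..N \<omega>. f i) = (\<Sum>i. indicator {\<omega>\<in>space M. Suc i \<le> N \<omega>} \<omega> * f (Suc i))"
    if "\<omega> \<in> space M" for \<omega> and f :: "nat \<Rightarrow> ennreal"
  proof -
    have "(\<Sum>i. indicator {\<omega>\<in>space M. Suc i \<le> N \<omega>} \<omega> * f (Suc i))
        = (\<Sum>i<N \<omega>. indicator {\<omega>\<in>space M. Suc i \<le> N \<omega>} \<omega> * f (Suc i))"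
      by (rule suminf_finite) (auto simp: indicator_def)
    also have "\<dots> = (\<Sum>i<N \<omega>. f (Suc i))" using that by (intro sum.cong) (auto simp: indicator_def)
    finally show ?thesis by (simp add: sum.atLeast1_atMost_eq)
  qed
  have "(\<integral>\<^sup>+ \<omega>. (\<Sum>i=1..N \<omega>. Z i \<omega>) \<partial>M)
      = (\<integral>\<^sup>+ \<omega>. (\<Sum>i. indicator {\<omega>\<in>space M. Suc i \<le> N \<omega>} \<omega> * Z (Suc i) \<omega>) \<partial>M)"
    using series by (intro nn_integral_cong) simp
  also have "\<dots> = (\<Sum>i. \<integral>\<^sup>+ \<omega>. indicator {\<omega>\<in>space M. Suc i \<le> N \<omega>} \<omega> * Z (Suc i) \<omega> \<partial>M)"
    by (rule nn_integral_suminf) measurable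
  also have "\<dots> = (\<Sum>i. (\<integral>\<^sup>+ \<omega>. indicator {\<omega>\<in>space M. Suc i \<le> N \<omega>} \<omega> \<partial>M) * m)"
    by (intro suminf_cong ind) simp
  also have "\<dots> = (\<Sum>i. \<integral>\<^sup>+ \<omega>. indicator {\<omega>\<in>space M. Suc i \<le> N \<omega>} \<omega> \<partial>M) * m"
    by simp
  also have "(\<Sum>i. \<integral>\<^sup>+ \<omega>. indicator {\<omega>\<in>space M. Suc i \<le> N \<omega>} \<omega> \<partial>M)
      = (\<integral>\<^sup>+ \<omega>. (\<Sum>i. indicator {\<omega>\<in>space M. Suc i \<le> N \<omega>} \<omega>) \<partial>M)"
    by (rule nn_integral_suminf[symmetric]) measurable
  also have "\<dots> = (\<integral>\<^sup>+ \<omega>. of_nat (N \<omega>) \<partial>M)"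
    using series[of _ "\<lambda>_. 1"] by (intro nn_integral_cong) simp
  finally show "(\<integral>\<^sup>+ \<omega>. (\<Sum>i=1..N \<omega>. Z i \<omega>) \<partial>M) = (\<integral>\<^sup>+ \<omega>. of_nat (N \<omega>) \<partial>M) * m" .
  have "(\<lambda>\<omega>. \<Sum>i. indicator {\<omega>\<in>space M. Suc i \<le> N \<omega>} \<omega> * Z (Suc i) \<omega>) \<in> borel_measurable M"
    by measurable
  thus "(\<lambda>\<omega>. \<Sum>i=1..N \<omega>. Z i \<omega>) \<in> borel_measurable M"
    by (rule measurable_cong[THEN iffD1, rotated]) (rule series[symmetric])
qed

text \<open>
  The sigma-algebras generated by \<open>f\<close> and \<open>g\<close> are contained in the independent ones
  \<open>A\<close> and \<open>B\<close>.
\<close>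

lemma nn_integral_mult_indep_set:
  fixes f g :: "'w \<Rightarrow> ennreal"
  assumes M: "prob_space M" and ind: "prob_space.indep_set M (sets A) (sets B)"
    and sp: "space A = space M" "space B = space M"
    and f: "f \<in> borel_measurable A" and g: "g \<in> borel_measurable B"
  shows "(\<integral>\<^sup>+ \<omega>. f \<omega> * g \<omega> \<partial>M) = (\<integral>\<^sup>+ \<omega>. f \<omega> \<partial>M) * (\<integral>\<^sup>+ \<omega>. g \<omega> \<partial>M)"
proof -
  interpret prob_space M by (rule M)
  have sub: "sets A \<subseteq> events" "sets B \<subseteq> events" using ind unfolding indep_set_def indep_sets_def
    by (auto simp: UNIV_bool)
  have fM: "f \<in> borel_measurable M"
    using f sub sp by (auto simp: measurable_def)
  have gM: "g \<in> borel_measurable M"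
    using g sub sp by (auto simp: measurable_def)
  have gen: "sigma_sets (space M) {h -` E \<inter> space M | E. E \<in> sets borel} \<subseteq> sets S"
    if "h \<in> borel_measurable S" "space S = space M" for h :: "'w \<Rightarrow> ennreal" and S
  proof -
    have "{h -` E \<inter> space M | E. E \<in> sets borel} \<subseteq> sets S"
      using measurable_sets[OF that(1)] that(2) by auto
    from sets.sigma_sets_subset[OF this] that(2) show ?thesis by simp
  qed
  have "indep_set (sigma_sets (space M) {f -` E \<inter> space M | E. E \<in> sets borel})
      (sigma_sets (space M) {g -` E \<inter> space M | E. E \<in> sets borel})"
    unfolding indep_set_def
    by (rule indep_sets_mono_sets[OF ind[unfolded indep_set_def]])
       (use gen[OF f sp(1)] gen[OF g sp(2)] in \<open>auto split: bool.splits\<close>)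
  hence "indep_var borel f borel g" unfolding indep_var_eq using fM gM by simp
  hence "indep_vars (\<lambda>_. borel) (case_bool f g) UNIV"
    unfolding indep_var_def by (rule indep_vars_cong[THEN iffD1, rotated -1]) (auto split: bool.splits)
  from indep_vars_nn_integral[OF _ this] show ?thesis by (simp add: UNIV_bool mult.commute)
qed

text \<open>
  Independence of the process from the sequence makes the event \<open>i \<le> N T\<close> independent of
  \<open>X i\<close>, which is the hypothesis of Wald's identity.
\<close>

lemma compound_poisson_mean:
  fixes X :: "nat \<Rightarrow> 'w \<Rightarrow> 'b::topological_space" and \<phi> :: "'b \<Rightarrow> ennreal"
  assumes M: "prob_space M" and r: "0 < r" and N: "poisson_process M r N"
    and X: "iid_sequence M X" and ind: "process_indep_sequence M N X"
    and \<phi>: "\<phi> \<in> borel_measurable borel" and T: "0 < T"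
  shows "(\<integral>\<^sup>+ \<omega>. (\<Sum>i=1..N T \<omega>. \<phi> (X i \<omega>)) \<partial>M) = ennreal (r * T) * (\<integral>\<^sup>+ \<omega>. \<phi> (X 1 \<omega>) \<partial>M)"
    and "(\<lambda>\<omega>. \<Sum>i=1..N T \<omega>. \<phi> (X i \<omega>)) \<in> borel_measurable M"
proof -
  interpret prob_space M by (rule M)
  have NT: "N T \<in> measurable M (count_space UNIV)" using N T by (auto simp: poisson_process_def)
  have XM: "X i \<in> borel_measurable M" if "1 \<le> i" for i
    using X that unfolding iid_sequence_def indep_vars_def by auto
  define A where "A = vimage_algebra (space M) (\<lambda>\<omega>. \<lambda>t\<in>{0::real..}. N t \<omega>) (\<Pi>\<^sub>M t\<in>{0..}. count_space UNIV)"
  define B where "B = vimage_algebra (space M) (\<lambda>\<omega>. \<lambda>i\<in>{1::nat..}. X i \<omega>) (\<Pi>\<^sub>M i\<in>{1..}. (borel :: 'b measure))"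
  have sp: "space A = space M" "space B = space M" by (simp_all add: A_def B_def)
  have AB: "indep_set (sets A) (sets B)"
    using ind unfolding process_indep_sequence_def A_def B_def .
  have "(\<lambda>\<omega>. \<lambda>t\<in>{0::real..}. N t \<omega>) \<in> measurable A (\<Pi>\<^sub>M t\<in>{0..}. count_space UNIV)"
    unfolding A_def by (rule measurable_vimage_algebra1) (auto simp: space_PiM)
  from measurable_component_singleton[THEN measurable_compose[OF this], of T]
  have NA: "N T \<in> measurable A (count_space UNIV)" using T by simp
  have "(\<lambda>\<omega>. \<lambda>i\<in>{1::nat..}. X i \<omega>) \<in> measurable B (\<Pi>\<^sub>M i\<in>{1..}. borel)"
    unfolding B_def by (rule measurable_vimage_algebra1) (auto simp: space_PiM)
  from measurable_component_singleton[THEN measurable_compose[OF this]]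
  have XB: "X i \<in> measurable B borel" if "1 \<le> i" for i using that by simp
  \<comment> \<open>Measurability is known for \<open>X i\<close> with \<open>i \<ge> 1\<close>, so the value at \<open>i = 0\<close> is replaced by \<open>0\<close>.\<close>
  define Z where "Z i \<omega> = (if i = 0 then 0 else \<phi> (X i \<omega>))" for i \<omega>
  have Z: "Z i \<in> borel_measurable M" for i
    using XM[of i] \<phi> by (cases "i = 0") (simp_all add: Z_def[abs_def] measurable_compose[OF _ \<phi>])
  have sumZ: "(\<Sum>i=1..n. \<phi> (X i \<omega>)) = (\<Sum>i=1..n. Z i \<omega>)" for n \<omega>
    by (intro sum.cong) (auto simp: Z_def)
  have step: "(\<integral>\<^sup>+ \<omega>. indicator {\<omega>\<in>space M. i \<le> N T \<omega>} \<omega> * Z i \<omega> \<partial>M)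
      = (\<integral>\<^sup>+ \<omega>. indicator {\<omega>\<in>space M. i \<le> N T \<omega>} \<omega> \<partial>M) * (\<integral>\<^sup>+ \<omega>. \<phi> (X 1 \<omega>) \<partial>M)" if i: "1 \<le> i" for i
  proof -
    have "{\<omega>\<in>space M. i \<le> N T \<omega>} = N T -` {i..} \<inter> space A" using sp by auto
    also have "\<dots> \<in> sets A" using NA by (rule measurable_sets) simp
    finally have "(indicator {\<omega>\<in>space M. i \<le> N T \<omega>} :: 'w \<Rightarrow> ennreal) \<in> borel_measurable A"
      by (rule borel_measurable_indicator)
    moreover have "(\<lambda>\<omega>. \<phi> (X i \<omega>)) \<in> borel_measurable B"
      by (rule measurable_compose[OF XB[OF i] \<phi>])
    ultimately have "(\<integral>\<^sup>+ \<omega>. indicator {\<omega>\<in>space M. i \<le> N T \<omega>} \<omega> * \<phi> (X i \<omega>) \<partial>M)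
        = (\<integral>\<^sup>+ \<omega>. indicator {\<omega>\<in>space M. i \<le> N T \<omega>} \<omega> \<partial>M) * (\<integral>\<^sup>+ \<omega>. \<phi> (X i \<omega>) \<partial>M)"
      by (rule nn_integral_mult_indep_set[OF M AB sp])
    also have "(\<integral>\<^sup>+ \<omega>. \<phi> (X i \<omega>) \<partial>M) = (\<integral>\<^sup>+ x. \<phi> x \<partial>distr M borel (X i))"
      by (subst nn_integral_distr) (simp_all add: XM[OF i] \<phi>)
    also have "distr M borel (X i) = distr M borel (X 1)" using X i unfolding iid_sequence_def by blast
    also have "(\<integral>\<^sup>+ x. \<phi> x \<partial>distr M borel (X 1)) = (\<integral>\<^sup>+ \<omega>. \<phi> (X 1 \<omega>) \<partial>M)"
      by (subst nn_integral_distr) (simp_all add: XM \<phi>)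
    finally show ?thesis using i by (simp add: Z_def)
  qed
  show "(\<integral>\<^sup>+ \<omega>. (\<Sum>i=1..N T \<omega>. \<phi> (X i \<omega>)) \<partial>M) = ennreal (r * T) * (\<integral>\<^sup>+ \<omega>. \<phi> (X 1 \<omega>) \<partial>M)"
    unfolding sumZ poisson_process_mean[OF M r N T, symmetric] by (rule wald_nn_integral(1)[OF NT Z step])
  show "(\<lambda>\<omega>. \<Sum>i=1..N T \<omega>. \<phi> (X i \<omega>)) \<in> borel_measurable M"
    unfolding sumZ by (rule wald_nn_integral(2)[OF NT Z step])
qed

section \<open>Distance of the square roots of the variance processes\<close>

theorem corollary6:
  fixes M :: "'w measure"
    and rate :: real
    and N :: "real \<Rightarrow> 'w \<Rightarrow> nat"
    and X :: "nat \<Rightarrow> 'w \<Rightarrow> 'h::{real_inner,banach,second_countable_topology} hs"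
    and V0 :: "'w \<Rightarrow> 'h hs"
    and C :: "'h hs \<Rightarrow>\<^sub>L 'h hs"
    and Cn :: "nat \<Rightarrow> 'h hs \<Rightarrow>\<^sub>L 'h hs"
    and V :: "real \<Rightarrow> 'w \<Rightarrow> 'h hs"
    and Vn :: "nat \<Rightarrow> real \<Rightarrow> 'w \<Rightarrow> 'h hs"
  assumes "prob_space M"
    and "rate > 0"
    and "poisson_process M rate N"
    and "iid_sequence M X"
    and "process_indep_sequence M N X"
    and "V0 \<in> borel_measurable M"
    and "bounded_on_trace_class C"
    and "\<And>n. n \<ge> 1 \<Longrightarrow> bounded_on_trace_class (Cn n)"
    and "variance_process M C V0 (compound_poisson N X) V"
    and "\<And>n. n \<ge> 1 \<Longrightarrow> variance_process M (Cn n) V0 (compound_poisson N X) (Vn n)"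
    and "AE \<omega> in M. \<forall>t\<ge>0. nonneg_definite (Rep_hs (V t \<omega>)) \<and> trace_class (Rep_hs (V t \<omega>))"
    and "\<And>n. n \<ge> 1 \<Longrightarrow>
      AE \<omega> in M. \<forall>t\<ge>0. nonneg_definite (Rep_hs (Vn n t \<omega>)) \<and> trace_class (Rep_hs (Vn n t \<omega>))"
  shows "\<exists>k::real. k > 0 \<and> (\<forall>n\<ge>1. \<forall>T>0.
    (\<integral>\<^sup>+ \<omega>. (SUP t\<in>{0..T}.
        (hs_norm (op_sqrt (Rep_hs (V t \<omega>)) - op_sqrt (Rep_hs (Vn n t \<omega>))))\<^sup>2) \<partial>M)
    \<le> ennreal (k * T * exp (T * max (trace_class_onorm C) (trace_class_onorm (Cn n))))
      * ((\<integral>\<^sup>+ \<omega>. trace_norm (Rep_hs (V0 \<omega>)) \<partial>M)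
         + ennreal (rate * T) * (\<integral>\<^sup>+ \<omega>. trace_norm (Rep_hs (X 1 \<omega>)) \<partial>M))
      * ennreal (trace_class_onorm (C - Cn n)))"
proof (intro exI[of _ 1] conjI allI impI)
  fix n :: nat and T :: real
  assume n: "1 \<le> n" and T: "0 < T"
  let ?m = "max (trace_class_onorm C) (trace_class_onorm (Cn n))"
  define S where "S \<omega> = (\<Sum>i=1..N T \<omega>. trace_norm (Rep_hs (X i \<omega>)))" for \<omega>
  have "AE \<omega> in M. mono_on {0..} (\<lambda>t. N t \<omega>)"
    using assms(3) unfolding poisson_process_def by (auto elim: AE_mp)
  moreover have "AE \<omega> in M. \<forall>t\<ge>0.
      ((\<lambda>s. C (V s \<omega>)) has_integral (V t \<omega> - V0 \<omega> - compound_poisson N X t \<omega>)) {0..t}"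
    using assms(9) unfolding variance_process_def by blast
  moreover have "AE \<omega> in M. \<forall>t\<ge>0.
      ((\<lambda>s. Cn n (Vn n s \<omega>)) has_integral (Vn n t \<omega> - V0 \<omega> - compound_poisson N X t \<omega>)) {0..t}"
    using assms(10)[OF n] unfolding variance_process_def by blast
  moreover note assms(11) assms(12)[OF n]
  ultimately have path: "AE \<omega> in M.
      (SUP t\<in>{0..T}. (hs_norm (op_sqrt (Rep_hs (V t \<omega>)) - op_sqrt (Rep_hs (Vn n t \<omega>))))\<^sup>2)
      \<le> ennreal (T * exp (T * ?m)) * (trace_norm (Rep_hs (V0 \<omega>)) + S \<omega>) * ennreal (trace_class_onorm (C - Cn n))"
  proof eventually_elim
    case (elim \<omega>)
    show ?case
    proof (rule SUP_least)
      fix t assume t: "t \<in> {0..T}"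
      have "(hs_norm (op_sqrt (Rep_hs (V t \<omega>)) - op_sqrt (Rep_hs (Vn n t \<omega>))))\<^sup>2
          \<le> trace_norm (Rep_hs (V t \<omega> - Vn n t \<omega>))"
        using elim t by (intro powers_stormer) auto
      also have "\<dots> \<le> ennreal (T * exp (T * ?m)) * (trace_norm (Rep_hs (V0 \<omega>)) + S \<omega>)
          * ennreal (trace_class_onorm (C - Cn n))"
        unfolding S_def
        by (rule variance_path_distance[OF assms(7) assms(8)[OF n] elim(1) _ _ _ t T])
           (use elim in \<open>auto simp: compound_poisson_def\<close>)
      finally show "(hs_norm (op_sqrt (Rep_hs (V t \<omega>)) - op_sqrt (Rep_hs (Vn n t \<omega>))))\<^sup>2
          \<le> ennreal (T * exp (T * ?m)) * (trace_norm (Rep_hs (V0 \<omega>)) + S \<omega>)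
            * ennreal (trace_class_onorm (C - Cn n))" .
    qed
  qed
  have [measurable]: "(\<lambda>\<omega>. trace_norm (Rep_hs (V0 \<omega>))) \<in> borel_measurable M"
    by (rule measurable_compose[OF assms(6) borel_measurable_trace_norm])
  note mean = compound_poisson_mean[OF assms(1-5) borel_measurable_trace_norm T, folded S_def]
  note [measurable] = mean(2)
  have "(\<integral>\<^sup>+ \<omega>. (SUP t\<in>{0..T}. (hs_norm (op_sqrt (Rep_hs (V t \<omega>)) - op_sqrt (Rep_hs (Vn n t \<omega>))))\<^sup>2) \<partial>M)
      \<le> (\<integral>\<^sup>+ \<omega>. ennreal (T * exp (T * ?m)) * (trace_norm (Rep_hs (V0 \<omega>)) + S \<omega>)
            * ennreal (trace_class_onorm (C - Cn n)) \<partial>M)"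
    by (rule nn_integral_mono_AE[OF path])
  also have "\<dots> = ennreal (T * exp (T * ?m)) * (\<integral>\<^sup>+ \<omega>. (trace_norm (Rep_hs (V0 \<omega>)) + S \<omega>) \<partial>M)
      * ennreal (trace_class_onorm (C - Cn n))"
    by (simp add: nn_integral_cmult nn_integral_multc)
  also have "(\<integral>\<^sup>+ \<omega>. (trace_norm (Rep_hs (V0 \<omega>)) + S \<omega>) \<partial>M)
      = (\<integral>\<^sup>+ \<omega>. trace_norm (Rep_hs (V0 \<omega>)) \<partial>M) + (\<integral>\<^sup>+ \<omega>. S \<omega> \<partial>M)"
    by (simp add: nn_integral_add)
  also note mean(1)
  finally show "(\<integral>\<^sup>+ \<omega>. (SUP t\<in>{0..T}. (hs_norm (op_sqrt (Rep_hs (V t \<omega>)) - op_sqrt (Rep_hs (Vn n t \<omega>))))\<^sup>2) \<partial>M)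
      \<le> ennreal (1 * T * exp (T * ?m))
        * ((\<integral>\<^sup>+ \<omega>. trace_norm (Rep_hs (V0 \<omega>)) \<partial>M) + ennreal (rate * T) * (\<integral>\<^sup>+ \<omega>. trace_norm (Rep_hs (X 1 \<omega>)) \<partial>M))
        * ennreal (trace_class_onorm (C - Cn n))"
    by simp
qed simp

end
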